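(* Let $T:E\to F$ be an order bounded almost weak Dunford-Pettis operator between Banach lattices. Then: (1) For all relatively weakly compact sets $A\subset E$, $B\subset F'$ and every $\varepsilon>0$ there exists $u\in E^+$ such that $|f|\big(T(|x|-u)^+\big)\le\varepsilon$ for all $x\in A$ and all $f\in B$. (2) For all relatively weakly compact sets $A\subset E$, $B\subset F'$ and every $\varepsilon>0$ there exists $g\in (F')^+$ such that $(|f|-g)^+\big(T|x|\big)\le\varepsilon$ for all $x\in A$ and all $f\in B$.
   Context: An operator is order bounded if it maps order bounded sets to order bounded sets. $T$ is almost weak Dunford-Pettis if $f_n(Tx_n)\to0$ whenever $(x_n)\subset E$ and $(f_n)\subset F'$ are disjoint weakly null sequences (disjoint meaning $|x_n|\wedge|x_m|=0$ for $n\neq m$). *)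

theory Defs
  imports "HOL-Analysis.Analysis"
begin

definition labs :: "'a::{lattice, uminus} \<Rightarrow> 'a" where
  "labs x = sup x (- x)"

definition ppart :: "'a::{lattice, zero} \<Rightarrow> 'a" where
  "ppart x = sup x 0"

definition npart :: "'a::{lattice, zero, uminus} \<Rightarrow> 'a" where
  "npart x = sup (- x) 0"

class banach_lattice = banach + ordered_real_vector + lattice +
  assumes norm_lattice: "sup x (- x) \<le> sup y (- y) \<Longrightarrow> norm x \<le> norm y"

definition order_bounded_set :: "'a::order set \<Rightarrow> bool" where
  "order_bounded_set S \<longleftrightarrow> (\<exists>a b. S \<subseteq> {a..b})"

definition order_bounded_op :: "('a::order \<Rightarrow> 'b::order) \<Rightarrow> bool" where
  "order_bounded_op T \<longleftrightarrow> (\<forall>S. order_bounded_set S \<longrightarrow> order_bounded_set (T ` S))"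

text \<open>For functionals f, g (elements of the dual), the supremum/infimum is given
on the positive cone by the Riesz--Kantorovich formulas and extended to all
vectors by y = y^+ - y^-.\<close>

definition dual_sup :: "('b::banach_lattice \<Rightarrow> real) \<Rightarrow> ('b \<Rightarrow> real) \<Rightarrow> 'b \<Rightarrow> real" where
  "dual_sup f g y =
     (SUP z\<in>{0..ppart y}. f z + g (ppart y - z)) - (SUP z\<in>{0..npart y}. f z + g (npart y - z))"

definition dual_inf :: "('b::banach_lattice \<Rightarrow> real) \<Rightarrow> ('b \<Rightarrow> real) \<Rightarrow> 'b \<Rightarrow> real" where
  "dual_inf f g y =
     (INF z\<in>{0..ppart y}. f z + g (ppart y - z)) - (INF z\<in>{0..npart y}. f z + g (npart y - z))"

definition dual_abs :: "('b::banach_lattice \<Rightarrow> real) \<Rightarrow> 'b \<Rightarrow> real" where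
  "dual_abs f = dual_sup f (\<lambda>y. - f y)"

definition dual_ppart :: "('b::banach_lattice \<Rightarrow> real) \<Rightarrow> 'b \<Rightarrow> real" where
  "dual_ppart f = dual_sup f (\<lambda>y. 0)"

definition dual_nonneg :: "('b::banach_lattice \<Rightarrow> real) \<Rightarrow> bool" where
  "dual_nonneg g \<longleftrightarrow> (\<forall>y. 0 \<le> y \<longrightarrow> 0 \<le> g y)"

definition weak_topology :: "'a::real_normed_vector topology" where
  "weak_topology = topology_generated_by
     {{x. blinfun_apply \<phi> x \<in> U} | (\<phi> :: 'a \<Rightarrow>\<^sub>L real) U. open U}"

definition rel_weakly_compact :: "'a::real_normed_vector set \<Rightarrow> bool" where
  "rel_weakly_compact A \<longleftrightarrow> compactin weak_topology (weak_topology closure_of A)"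

definition weakly_null :: "(nat \<Rightarrow> 'a::real_normed_vector) \<Rightarrow> bool" where
  "weakly_null x \<longleftrightarrow> (\<forall>\<phi> :: 'a \<Rightarrow>\<^sub>L real. (\<lambda>n. \<phi> (x n)) \<longlonglongrightarrow> 0)"

definition disjoint_seq :: "(nat \<Rightarrow> 'a::banach_lattice) \<Rightarrow> bool" where
  "disjoint_seq x \<longleftrightarrow> (\<forall>n m. n \<noteq> m \<longrightarrow> inf (labs (x n)) (labs (x m)) = 0)"

definition dual_disjoint_seq :: "(nat \<Rightarrow> ('b::banach_lattice \<Rightarrow>\<^sub>L real)) \<Rightarrow> bool" where
  "dual_disjoint_seq f \<longleftrightarrow> (\<forall>n m. n \<noteq> m \<longrightarrow>
      dual_inf (dual_abs (blinfun_apply (f n))) (dual_abs (blinfun_apply (f m))) = (\<lambda>y. 0))"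

definition almost_weak_DP :: "('a::banach_lattice \<Rightarrow> 'b::banach_lattice) \<Rightarrow> bool" where
  "almost_weak_DP T \<longleftrightarrow>
     (\<forall>(x :: nat \<Rightarrow> 'a) (f :: nat \<Rightarrow> ('b \<Rightarrow>\<^sub>L real)).
        disjoint_seq x \<and> weakly_null x \<and> dual_disjoint_seq f \<and> weakly_null f \<longrightarrow>
        (\<lambda>n. f n (T (x n))) \<longlonglongrightarrow> 0)"

end

theory Submission
  imports Defs "HOL-Library.Lattice_Algebras"
begin

text \<open>Both parts are instances of one statement about the bilinear form \<open>b x g = g (T x)\<close> on
  \<open>E \<times> F'\<close>. If no \<open>u\<close> works, one finds \<open>x\<^sub>n \<in> A\<close> and \<open>f\<^sub>n \<in> B\<close> with
  \<open>|f\<^sub>n| (T (|x\<^sub>n| - 4\<^sup>n \<Sum>i<n. |x\<^sub>i|)\<^sup>+) > \<epsilon>\<close>, and up to a norm null sequence these positive parts are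
  disjoint vectors \<open>v\<^sub>n \<le> |x\<^sub>n|\<close>. Along a subsequence the same construction replaces \<open>|f\<^sub>n|\<close> by disjoint
  functionals \<open>g\<^sub>n \<le> |f\<^sub>n|\<close>, because \<open>h |T v\<^sub>n| \<rightarrow> 0\<close> for each fixed \<open>h \<in> F'\<^sup>+\<close>. A disjoint sequence in the
  solid hull of a relatively weakly compact set is weakly null: restricting a positive functional
  to the bands of its members gives an operator into \<open>\<ell>\<^sup>1\<close>, to which the Schur property applies.
  Hence \<open>g\<^sub>n (T v\<^sub>n) \<rightarrow> 0\<close>, a contradiction. The second part exchanges the roles of \<open>E\<close> and \<open>F'\<close>.\<close>

subsection \<open>Banach lattices\<close>

text \<open>The hypothesis on \<open>T\<close> speaks only about pairs of sequences that are
  disjoint on both sides, so two disjointifications have to be combined. The second one discards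
  from each chosen functional its part below an element \<open>h\<close> fixed before the index is
  chosen; this loss is small only if the vectors \<open>T v_n\<close> are small uniformly on all of
  \<open>[0, h]\<close>. That is where order boundedness enters: for \<open>x \<ge> 0\<close> the
  value \<open>h |T x|\<close> is dominated by a positive functional of \<open>x\<close>, and with
  exchanged roles \<open>T [0, h]\<close> lies in an order interval, on which disjoint functionals
  are uniformly small. The other obstacle is that the solid hull of a relatively weakly compact set
  need not be relatively weakly compact. Elements dominated by \<open>|x_n|\<close> are therefore
  tested with signed functionals that recover, from \<open>x_n\<close> itself, the value of a
  positive functional at \<open>|x_n|\<close>. Weak compactness is used only through boundedness and
  through weak cluster points of sequences; no weakly convergent subsequence is extracted.\<close>

instance banach_lattice \<subseteq> lattice_ab_group_add ..

lemma labs_ge_self: "x \<le> labs x" and labs_ge_minus: "- x \<le> labs x"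
  for x :: "'a::banach_lattice"
  by (auto simp: labs_def)

lemma labs_leI: "x \<le> b \<Longrightarrow> - x \<le> b \<Longrightarrow> labs x \<le> b" for x :: "'a::banach_lattice"
  by (simp add: labs_def)

lemma labs_nonneg [simp]: "0 \<le> labs x" for x :: "'a::banach_lattice"
proof -
  have "0 \<le> labs x + labs x"
    using add_mono[OF labs_ge_self[of x] labs_ge_minus[of x]] by simp
  then show ?thesis by simp
qed

lemma labs_of_nonneg [simp]: "0 \<le> x \<Longrightarrow> labs x = x" for x :: "'a::banach_lattice"
  unfolding labs_def by (meson dual_order.trans neg_le_0_iff_le sup.absorb1)

lemma labs_minus [simp]: "labs (- x) = labs x" for x :: "'a::banach_lattice"
  by (simp add: labs_def sup_commute)

lemma ppart_nonneg [simp]: "0 \<le> ppart x" and npart_nonneg [simp]: "0 \<le> npart x"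
  and le_ppart: "x \<le> ppart x"
  for x :: "'a::banach_lattice"
  by (simp_all add: ppart_def npart_def)

lemma ppart_of_nonneg [simp]: "0 \<le> x \<Longrightarrow> ppart x = x"
  and npart_of_nonneg [simp]: "0 \<le> x \<Longrightarrow> npart x = 0"
  for x :: "'a::banach_lattice"
  by (simp_all add: ppart_def npart_def sup_absorb1 sup_absorb2)

lemma ppart_mono: "x \<le> y \<Longrightarrow> ppart x \<le> ppart y" for x y :: "'a::banach_lattice"
  unfolding ppart_def by (rule sup_mono) auto

lemma npart_eq_ppart_diff: "npart x = ppart x - x" for x :: "'a::banach_lattice"
proof -
  have "sup x 0 + - x = sup (x + - x) (0 + - x)" by (rule add_sup_distrib_right)
  then show ?thesis by (simp add: ppart_def npart_def sup_commute)
qed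

lemma ppart_minus_npart: "ppart x - npart x = x" for x :: "'a::banach_lattice"
  by (simp add: npart_eq_ppart_diff)

lemma diff_inf_eq_ppart: "x - inf x y = ppart (x - y)" for x y :: "'a::banach_lattice"
proof -
  have "x - inf x y = x + sup (- x) (- y)" by (rule diff_inf_eq_sup)
  also have "\<dots> = sup (x + - x) (x + - y)" by (rule add_sup_distrib_left)
  finally show ?thesis by (simp add: ppart_def sup_commute)
qed

lemma inf_ppart_npart: "inf (ppart x) (npart x) = 0" for x :: "'a::banach_lattice"
proof -
  have "inf (x + npart x) (0 + npart x) = inf x 0 + npart x"
    by (rule add_inf_distrib_right[symmetric])
  also have "inf x 0 = - npart x"
    unfolding npart_def using inf_eq_neg_sup[of x 0] by simp
  finally show ?thesis by (simp add: npart_eq_ppart_diff)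
qed

lemma labs_eq_parts: "labs x = ppart x + npart x" for x :: "'a::banach_lattice"
proof -
  have "ppart x + npart x = sup (ppart x) (npart x)"
    using add_eq_inf_sup[of "ppart x" "npart x"] inf_ppart_npart[of x] by simp
  also have "\<dots> = sup (labs x) 0"
    by (simp add: ppart_def npart_def labs_def sup_assoc sup_commute sup_left_commute)
  finally show ?thesis by (simp add: sup_absorb1)
qed

lemma norm_labs [simp]: "norm (labs x) = norm x" for x :: "'a::banach_lattice"
  by (rule antisym; rule norm_lattice; fold labs_def; simp)

lemma norm_mono_labs: "labs x \<le> labs y \<Longrightarrow> norm x \<le> norm y" for x y :: "'a::banach_lattice"
  unfolding labs_def by (rule norm_lattice)

lemma norm_mono_nonneg: "0 \<le> x \<Longrightarrow> x \<le> y \<Longrightarrow> norm x \<le> norm y" for x y :: "'a::banach_lattice"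
  by (rule norm_mono_labs) (metis labs_of_nonneg order_trans)

text \<open>Addition distributes over \<open>inf\<close>, so the right-hand side is the infimum of
  the four sums \<open>x + y\<close>, \<open>x + z\<close>, \<open>z + y\<close> and
  \<open>z + z\<close>, each of which dominates the left-hand side.\<close>

lemma inf_add_le:
  fixes x y z :: "'a::banach_lattice"
  assumes "0 \<le> x" "0 \<le> y" "0 \<le> z"
  shows "inf (x + y) z \<le> inf x z + inf y z"
proof -
  have "inf x z + inf y z = inf (inf (x + y) (x + z)) (inf (z + y) (z + z))"
    by (simp add: add_inf_distrib_left add_inf_distrib_right inf.commute inf.left_commute inf.assoc)
  moreover have "inf (x + y) z \<le> x + z" "inf (x + y) z \<le> z + y" "inf (x + y) z \<le> z + z"
    using assms by (auto intro!: le_infI2 simp: add_increasing add_increasing2)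
  ultimately show ?thesis by (simp add: le_infI1)
qed

lemma inf_add_zero:
  fixes x y z :: "'a::banach_lattice"
  assumes "0 \<le> x" "0 \<le> y" "0 \<le> z" "inf x z = 0" "inf y z = 0"
  shows "inf (x + y) z = 0"
  using inf_add_le[OF assms(1-3)] assms by (intro antisym) auto

lemma inf_scaleR_zero:
  fixes x y :: "'a::banach_lattice"
  assumes "0 \<le> x" "0 \<le> y" "inf x y = 0"
  shows "inf (of_nat n *\<^sub>R x) y = 0"
proof (induction n)
  case 0
  then show ?case using assms by (simp add: inf_absorb1)
next
  case (Suc n)
  have "of_nat (Suc n) *\<^sub>R x = x + of_nat n *\<^sub>R x" by (simp add: scaleR_add_left)
  then show ?case using inf_add_zero[of x "of_nat n *\<^sub>R x" y] assms Suc
    by (simp add: scaleR_nonneg_nonneg)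
qed

lemma inf_zero_mono:
  fixes x y :: "'a::banach_lattice"
  assumes "0 \<le> x'" "0 \<le> y'" "x' \<le> x" "y' \<le> y" "inf x y = 0"
  shows "inf x' y' = 0"
  using assms by (metis antisym inf_greatest inf_mono)

text \<open>A sum of pairwise disjoint positive elements is also their supremum.\<close>

lemma sum_disjoint_le:
  fixes a :: "nat \<Rightarrow> 'a::banach_lattice"
  assumes "\<And>n. 0 \<le> a n" "\<And>n. a n \<le> x" "\<And>m n. m \<noteq> n \<Longrightarrow> inf (a m) (a n) = 0"
  shows "(\<Sum>n<N. a n) \<le> x"
proof -
  have *: "inf (\<Sum>n<N. a n) (a k) = 0" if "N \<le> k" for N k
    using that
  proof (induction N)
    case 0
    then show ?case using assms by (simp add: inf_absorb1)
  next
    case (Suc N)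
    then show ?case
      using inf_add_zero[of "\<Sum>n<N. a n" "a N" "a k"] assms by (simp add: sum_nonneg)
  qed
  show ?thesis
  proof (induction N)
    case 0
    then show ?case using order_trans[OF assms(1,2)] by simp
  next
    case (Suc N)
    have "(\<Sum>n<N. a n) + a N = sup (\<Sum>n<N. a n) (a N)"
      using add_eq_inf_sup[of "\<Sum>n<N. a n" "a N"] *[of N N] by simp
    then show ?case using Suc assms by simp
  qed
qed

lemma riesz_decomposition:
  fixes x y z :: "'a::banach_lattice"
  assumes "0 \<le> x" "0 \<le> y" "0 \<le> z" "z \<le> x + y"
  obtains a b where "z = a + b" "0 \<le> a" "a \<le> x" "0 \<le> b" "b \<le> y"
proof
  show "z = inf z x + ppart (z - x)" by (metis add.commute diff_add_cancel diff_inf_eq_ppart)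
  show "0 \<le> inf z x" "inf z x \<le> x" "0 \<le> ppart (z - x)" using assms by auto
  show "ppart (z - x) \<le> y" using assms by (simp add: ppart_def diff_le_eq add.commute)
qed

text \<open>Because \<open>s n \<ge> 0\<close>, the negative part of the limit is dominated by
  \<open>|l - s n|\<close>, whose norm tends to zero.\<close>

lemma closed_nonneg: "closed {x::'a::banach_lattice. 0 \<le> x}"
proof (clarsimp simp: closed_sequential_limits)
  fix s and l :: 'a
  assume s: "\<forall>n. 0 \<le> s n" "s \<longlonglongrightarrow> l"
  have "norm (npart l) \<le> norm (l - s n)" for n
  proof -
    have "- l \<le> labs (l - s n)"
      using labs_ge_minus[of "l - s n"] s(1) order_trans[of "- l" "s n - l" "labs (l - s n)"] by simp
    then have "npart l \<le> labs (l - s n)" by (simp add: npart_def)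
    then show ?thesis using norm_mono_nonneg[of "npart l" "labs (l - s n)"] by simp
  qed
  moreover have "(\<lambda>n. norm (l - s n)) \<longlonglongrightarrow> 0"
    using tendsto_norm[OF tendsto_diff[OF tendsto_const s(2)], of l] by simp
  ultimately have "norm (npart l) \<le> 0" by (meson LIMSEQ_le_const)
  then show "0 \<le> l" using ppart_minus_npart[of l] ppart_nonneg[of l] by simp
qed

lemma LIMSEQ_lattice_le_const:
  fixes l :: "'a::banach_lattice"
  assumes "s \<longlonglongrightarrow> l" "\<And>n. n \<ge> N \<Longrightarrow> a \<le> s n"
  shows "a \<le> l"
proof -
  have "(\<lambda>n. s (n + N) - a) \<longlonglongrightarrow> l - a"
    by (intro tendsto_intros LIMSEQ_ignore_initial_segment assms)
  then have "l - a \<in> {x. 0 \<le> x}"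
    by (rule closed_sequentially[OF closed_nonneg, rotated]) (use assms in auto)
  then show ?thesis by simp
qed

lemma term_le_suminf:
  fixes f :: "nat \<Rightarrow> 'a::banach_lattice"
  assumes "summable f" "\<And>n. 0 \<le> f n"
  shows "f n \<le> suminf f"
proof (rule LIMSEQ_lattice_le_const[OF summable_LIMSEQ[OF assms(1)]])
  fix m assume "m \<ge> Suc n"
  then show "f n \<le> (\<Sum>i<m. f i)" using sum_mono2[of "{..<m}" "{n}" f] assms by auto
qed

text \<open>If \<open>T\<close> were unbounded, some \<open>x\<^sub>n\<close> with \<open>\<parallel>x\<^sub>n\<parallel> \<le> 2\<^sup>-\<^sup>n\<close> would have \<open>\<parallel>T x\<^sub>n\<parallel> \<ge> n\<close>, although
  all of them lie in the order interval of \<open>\<Sum>n. |x\<^sub>n|\<close>.\<close>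

lemma bounded_linear_if_bounded_on_intervals:
  fixes T :: "'a::banach_lattice \<Rightarrow> 'b::real_normed_vector"
  assumes "linear T" "\<And>x. 0 \<le> x \<Longrightarrow> bounded (T ` {- x..x})"
  shows "bounded_linear T"
proof (rule ccontr)
  assume "\<not> bounded_linear T"
  then have nb: "\<not> (\<exists>K. \<forall>x. norm (T x) \<le> norm x * K)"
    using assms(1) by (auto simp: bounded_linear_def bounded_linear_axioms_def)
  have "\<exists>x. norm x \<le> (1/2) ^ n \<and> norm (T x) \<ge> real n" for n
  proof -
    from nb obtain z where z: "norm (T z) > norm z * (real n * 2 ^ n)" by (meson not_le)
    have nz: "norm z > 0" using z assms(1) by (auto simp: linear_0)
    define x where "x = ((1/2) ^ n / norm z) *\<^sub>R z"
    have "norm x = (1/2) ^ n" using nz by (simp add: x_def)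
    moreover have "norm (T x) = ((1/2) ^ n / norm z) * norm (T z)"
      using assms(1) by (simp add: x_def linear_scale)
    moreover have "((1/2) ^ n / norm z) * norm (T z) \<ge> ((1/2) ^ n / norm z) * (norm z * (real n * 2 ^ n))"
      using z by (intro mult_left_mono) auto
    ultimately show ?thesis using nz by (intro exI[of _ x]) (simp add: power_one_over)
  qed
  then obtain x where x: "\<And>n. norm (x n) \<le> (1/2) ^ n" "\<And>n. norm (T (x n)) \<ge> real n" by metis
  have sm: "summable (\<lambda>n. labs (x n))"
    by (rule summable_comparison_test'[of "\<lambda>n. (1/2) ^ n"]) (use x in auto)
  define y where "y = (\<Sum>n. labs (x n))"
  have xy: "labs (x n) \<le> y" for n unfolding y_def by (rule term_le_suminf[OF sm]) simp
  have "x n \<in> {- y..y}" for n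
    using order_trans[OF labs_ge_self xy] order_trans[OF labs_ge_minus xy] by (auto simp: minus_le_iff)
  moreover have "0 \<le> y" using order_trans[OF labs_nonneg xy] .
  ultimately obtain B where B: "\<And>n. norm (T (x n)) \<le> B"
    using assms(2) by (metis bounded_iff image_eqI)
  obtain n where "B < real n" using reals_Archimedean2 by blast
  then show False using B[of n] x(2)[of n] by simp
qed

lemma labs_le_of_mem_interval:
  fixes a b x :: "'a::banach_lattice"
  assumes "x \<in> {a..b}"
  shows "labs x \<le> labs a + labs b"
proof (rule labs_leI)
  show "x \<le> labs a + labs b"
    using assms labs_ge_self[of b] order_trans[of x b "labs b"] by (simp add: add_increasing)
  have "- x \<le> - a" using assms by simp
  also have "\<dots> \<le> labs a" by (rule labs_ge_minus)
  finally show "- x \<le> labs a + labs b" by (simp add: add_increasing2)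
qed

lemma order_bounded_op_interval:
  assumes "order_bounded_op T"
  shows "\<exists>a b. T ` {l..u} \<subseteq> {a..b}"
proof -
  have "order_bounded_set {l..u}" by (auto simp: order_bounded_set_def)
  then show ?thesis using assms by (simp add: order_bounded_op_def order_bounded_set_def)
qed

lemma order_bounded_imp_bounded_linear:
  fixes T :: "'a::banach_lattice \<Rightarrow> 'b::banach_lattice"
  assumes "linear T" "order_bounded_op T"
  shows "bounded_linear T"
proof (rule bounded_linear_if_bounded_on_intervals[OF assms(1)])
  fix x :: 'a
  obtain a b where "T ` {- x..x} \<subseteq> {a..b}" using order_bounded_op_interval[OF assms(2)] by blast
  then have "labs t \<le> labs (labs a + labs b)" if "t \<in> T ` {- x..x}" for t
    using labs_le_of_mem_interval[of t a b] that by auto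
  then show "bounded (T ` {- x..x})"
    unfolding bounded_iff using norm_mono_labs by blast
qed

subsection \<open>The dual Banach lattice\<close>

lemma blinfun_mono:
  fixes q :: "'a::banach_lattice \<Rightarrow>\<^sub>L real"
  assumes "\<And>x. 0 \<le> x \<Longrightarrow> 0 \<le> q x" "x \<le> y"
  shows "q x \<le> q y"
  using assms(1)[of "y - x"] assms(2) by (simp add: blinfun.diff_right)

lemma abs_blinfun_le_labs:
  fixes q :: "'a::banach_lattice \<Rightarrow>\<^sub>L real"
  assumes "\<And>x. 0 \<le> x \<Longrightarrow> 0 \<le> q x"
  shows "\<bar>q x\<bar> \<le> q (labs x)"
  using blinfun_mono[OF assms labs_ge_self[of x]] blinfun_mono[OF assms labs_ge_minus[of x]]
  by (simp add: blinfun.minus_right)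

text \<open>Additivity gives natural multiples. For real \<open>c\<close>, squeezing
  \<open>n * c\<close> between consecutive naturals shows by monotonicity that \<open>n\<close>
  times the defect of homogeneity is at most \<open>p x\<close> for every \<open>n\<close>, so the
  defect is zero.\<close>

lemma cone_additive_scaleR:
  fixes p :: "'a::banach_lattice \<Rightarrow> real"
  assumes add: "\<And>x y. 0 \<le> x \<Longrightarrow> 0 \<le> y \<Longrightarrow> p (x + y) = p x + p y"
    and nonneg: "\<And>x. 0 \<le> x \<Longrightarrow> 0 \<le> p x"
    and "0 \<le> c" "0 \<le> x"
  shows "p (c *\<^sub>R x) = c * p x"
proof -
  have p0: "p 0 = 0" using add[of 0 0] by simp
  have mono: "p a \<le> p b" if "0 \<le> a" "a \<le> b" for a b
    using add[of a "b - a"] nonneg[of "b - a"] that by simp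
  have nat: "p (real n *\<^sub>R z) = real n * p z" if "0 \<le> z" for n z
  proof (induction n)
    case (Suc n)
    have "real (Suc n) *\<^sub>R z = real n *\<^sub>R z + z" by (simp add: scaleR_add_left)
    then show ?case using add[of "real n *\<^sub>R z" z] Suc that
      by (simp add: scaleR_nonneg_nonneg algebra_simps)
  qed (simp add: p0)
  have "\<bar>real n * (p (c *\<^sub>R x) - c * p x)\<bar> \<le> p x" for n
  proof -
    define m where "m = nat \<lfloor>real n * c\<rfloor>"
    have m: "real m \<le> real n * c" "real n * c \<le> real (m + 1)"
      unfolding m_def using \<open>0 \<le> c\<close> real_of_int_floor_add_one_ge[of "real n * c"]
      by (auto simp: add.commute)
    have eq: "real n * p (c *\<^sub>R x) = p ((real n * c) *\<^sub>R x)"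
      using nat[of "c *\<^sub>R x" n] assms by (simp add: scaleR_nonneg_nonneg)
    have "p (real m *\<^sub>R x) \<le> p ((real n * c) *\<^sub>R x)"
      using m assms by (intro mono scaleR_right_mono) (auto simp: scaleR_nonneg_nonneg)
    moreover have "p ((real n * c) *\<^sub>R x) \<le> p (real (m + 1) *\<^sub>R x)"
      using m assms by (intro mono scaleR_right_mono) (auto simp: scaleR_nonneg_nonneg)
    ultimately have 1: "real m * p x \<le> real n * p (c *\<^sub>R x)" "real n * p (c *\<^sub>R x) \<le> real (m + 1) * p x"
      unfolding eq nat[OF \<open>0 \<le> x\<close>] by auto
    have 2: "real m * p x \<le> real n * c * p x" "real n * c * p x \<le> real (m + 1) * p x"
      using m nonneg[OF \<open>0 \<le> x\<close>] by (auto intro: mult_right_mono)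
    show ?thesis using 1 2 by (simp add: algebra_simps abs_le_iff)
  qed
  then have b: "real n * \<bar>p (c *\<^sub>R x) - c * p x\<bar> \<le> p x" for n by (simp add: abs_mult)
  show ?thesis
  proof (rule ccontr)
    assume "p (c *\<^sub>R x) \<noteq> c * p x"
    then obtain n where "p x < real n * \<bar>p (c *\<^sub>R x) - c * p x\<bar>"
      using reals_Archimedean3[of "\<bar>p (c *\<^sub>R x) - c * p x\<bar>"] by auto
    then show False using b[of n] by simp
  qed
qed

text \<open>Kantorovich's extension \<open>p (ppart x) - p (npart x)\<close>. The value on a
  difference \<open>a - b\<close> of positive elements does not depend on the representation
  (\<open>qd\<close>), which yields linearity; continuity is automatic, as a positive functional is
  bounded on order intervals.\<close>

lemma cone_additive_extension:
  fixes p :: "'a::banach_lattice \<Rightarrow> real"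
  assumes add: "\<And>x y. 0 \<le> x \<Longrightarrow> 0 \<le> y \<Longrightarrow> p (x + y) = p x + p y"
    and nonneg: "\<And>x. 0 \<le> x \<Longrightarrow> 0 \<le> p x"
  shows "\<exists>q::'a \<Rightarrow>\<^sub>L real. \<forall>x\<ge>0. q x = p x"
proof -
  define q where "q x = p (ppart x) - p (npart x)" for x
  have p0: "p 0 = 0" using add[of 0 0] by simp
  have qd: "q (a - b) = p a - p b" if "0 \<le> a" "0 \<le> b" for a b
  proof -
    have "ppart (a - b) - npart (a - b) = a - b" by (rule ppart_minus_npart)
    then have "ppart (a - b) + b = a + npart (a - b)" by (simp add: algebra_simps)
    then have "p (ppart (a - b)) + p b = p a + p (npart (a - b))"
      using add[of "ppart (a - b)" b] add[of a "npart (a - b)"] that by simp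
    then show ?thesis by (simp add: q_def)
  qed
  have qp: "q x = p x" if "0 \<le> x" for x using that by (simp add: q_def p0)
  have lin: "linear q"
  proof (rule linearI)
    fix x y :: 'a
    have "x + y = (ppart x + ppart y) - (npart x + npart y)"
      using ppart_minus_npart[of x] ppart_minus_npart[of y] by (simp add: algebra_simps)
    then have "q (x + y) = p (ppart x + ppart y) - p (npart x + npart y)"
      using qd[of "ppart x + ppart y" "npart x + npart y"] by simp
    then show "q (x + y) = q x + q y" by (simp add: add q_def)
  next
    fix c and x :: 'a
    have pos: "q (c *\<^sub>R x) = c * q x" if "0 \<le> c" for c x
    proof -
      have "c *\<^sub>R x = c *\<^sub>R ppart x - c *\<^sub>R npart x"
        by (metis ppart_minus_npart scaleR_diff_right)
      then have "q (c *\<^sub>R x) = p (c *\<^sub>R ppart x) - p (c *\<^sub>R npart x)"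
        using qd[of "c *\<^sub>R ppart x" "c *\<^sub>R npart x"] that by (simp add: scaleR_nonneg_nonneg)
      then show ?thesis
        using cone_additive_scaleR[OF add nonneg, of c] that by (simp add: q_def algebra_simps)
    qed
    have neg: "q (- x) = - q x" for x
      using qd[of "npart x" "ppart x"] ppart_minus_npart[of x] q_def[of x]
      by (metis minus_diff_eq npart_nonneg ppart_nonneg)
    show "q (c *\<^sub>R x) = c *\<^sub>R q x"
    proof (cases "0 \<le> c")
      case False
      then have "q (- (- c *\<^sub>R x)) = - (- c * q x)" using neg pos[of "- c" x] by simp
      then show ?thesis by simp
    qed (simp add: pos)
  qed
  have "bounded_linear q"
  proof (rule bounded_linear_if_bounded_on_intervals[OF lin])
    fix x :: 'a assume "0 \<le> x"
    have mono: "q a \<le> q b" if "a \<le> b" for a b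
      using nonneg[of "b - a"] qp[of "b - a"] linear_diff[OF lin, of b a] that by simp
    have "\<bar>q y\<bar> \<le> q x" if "y \<in> {- x..x}" for y
      using mono[of y x] mono[of "- x" y] that linear_neg[OF lin, of x] by auto
    then show "bounded (q ` {- x..x})" unfolding bounded_iff by (auto intro!: exI[of _ "q x"])
  qed
  then show ?thesis using qp by (intro exI[of _ "Blinfun q"]) (simp add: bounded_linear_Blinfun_apply)
qed

definition cone_extension :: "('a::banach_lattice \<Rightarrow> real) \<Rightarrow> 'a \<Rightarrow>\<^sub>L real" where
  "cone_extension p = (SOME q. \<forall>x\<ge>0. blinfun_apply q x = p x)"

lemma cone_extension_apply:
  fixes p :: "'a::banach_lattice \<Rightarrow> real"
  assumes "\<And>x y. 0 \<le> x \<Longrightarrow> 0 \<le> y \<Longrightarrow> p (x + y) = p x + p y"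
    and "\<And>x. 0 \<le> x \<Longrightarrow> 0 \<le> p x" and "0 \<le> x"
  shows "cone_extension p x = p x"
  using someI_ex[OF cone_additive_extension[OF assms(1,2)]] assms(3)
  unfolding cone_extension_def by blast

lemma blinfun_eq_on_cone:
  fixes f g :: "'a::banach_lattice \<Rightarrow>\<^sub>L real"
  assumes "\<And>x. 0 \<le> x \<Longrightarrow> f x = g x"
  shows "f = g"
proof (rule blinfun_eqI)
  fix x
  have "f (ppart x - npart x) = g (ppart x - npart x)" by (simp add: blinfun.diff_right assms)
  then show "f x = g x" by (simp add: ppart_minus_npart)
qed

section \<open>The Riesz--Kantorovich construction of the positive part of a functional\<close>

lemma bdd_above_blinfun_interval:
  fixes f :: "'a::banach_lattice \<Rightarrow>\<^sub>L real"
  shows "bdd_above (blinfun_apply f ` {0..x})"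
proof (rule bdd_aboveI2)
  fix z assume "z \<in> {0..x}"
  then have "norm z \<le> norm x" by (auto intro: norm_mono_nonneg)
  have "f z \<le> norm f * norm z" using norm_blinfun[of f z] by simp
  also have "\<dots> \<le> norm f * norm x" using \<open>norm z \<le> norm x\<close> by (intro mult_left_mono) auto
  finally show "f z \<le> norm f * norm x" .
qed

definition blinfun_ppart :: "('a::banach_lattice \<Rightarrow>\<^sub>L real) \<Rightarrow> 'a \<Rightarrow>\<^sub>L real" where
  "blinfun_ppart f = cone_extension (\<lambda>x. SUP z\<in>{0..x}. f z)"

text \<open>Only additivity on the cone has to be checked: one inequality splits an element of
  \<open>[0, x + y]\<close> by Riesz decomposition, the other adds elements of \<open>[0, x]\<close>
  and \<open>[0, y]\<close>.\<close>

lemma blinfun_ppart_apply: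
  fixes f :: "'a::banach_lattice \<Rightarrow>\<^sub>L real"
  assumes "0 \<le> x"
  shows "blinfun_ppart f x = (SUP z\<in>{0..x}. f z)"
  unfolding blinfun_ppart_def
proof (rule cone_extension_apply[OF _ _ assms])
  fix x :: 'a assume "0 \<le> x"
  then show "0 \<le> (SUP z\<in>{0..x}. f z)"
    by (intro cSUP_upper2[OF bdd_above_blinfun_interval, of 0]) auto
next
  fix x y :: 'a assume xy: "0 \<le> x" "0 \<le> y"
  show "(SUP z\<in>{0..x+y}. f z) = (SUP z\<in>{0..x}. f z) + (SUP z\<in>{0..y}. f z)"
  proof (rule antisym)
    show "(SUP z\<in>{0..x+y}. f z) \<le> (SUP z\<in>{0..x}. f z) + (SUP z\<in>{0..y}. f z)"
    proof (rule cSUP_least)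
      fix z assume "z \<in> {0..x + y}"
      then obtain a b where "z = a + b" "a \<in> {0..x}" "b \<in> {0..y}"
        using riesz_decomposition[OF xy, of z] by (metis atLeastAtMost_iff)
      then show "f z \<le> (SUP z\<in>{0..x}. f z) + (SUP z\<in>{0..y}. f z)"
        by (auto simp: blinfun.add_right intro!: add_mono cSUP_upper bdd_above_blinfun_interval)
    qed (use xy in auto)
    have "(SUP z\<in>{0..x}. f z) \<le> (SUP z\<in>{0..x+y}. f z) - (SUP z\<in>{0..y}. f z)"
    proof (rule cSUP_least)
      fix a assume a: "a \<in> {0..x}"
      have "(SUP z\<in>{0..y}. f z) \<le> (SUP z\<in>{0..x+y}. f z) - f a"
      proof (rule cSUP_least)
        fix b assume "b \<in> {0..y}"
        then have "f (a + b) \<le> (SUP z\<in>{0..x+y}. f z)"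
          using a by (intro cSUP_upper bdd_above_blinfun_interval) (auto intro: add_mono)
        then show "f b \<le> (SUP z\<in>{0..x+y}. f z) - f a" by (simp add: blinfun.add_right)
      qed (use xy in auto)
      then show "f a \<le> (SUP z\<in>{0..x+y}. f z) - (SUP z\<in>{0..y}. f z)" by simp
    qed (use xy in auto)
    then show "(SUP z\<in>{0..x}. f z) + (SUP z\<in>{0..y}. f z) \<le> (SUP z\<in>{0..x+y}. f z)" by simp
  qed
qed

lemma blinfun_ppart_ge:
  fixes f :: "'a::banach_lattice \<Rightarrow>\<^sub>L real"
  shows "0 \<le> z \<Longrightarrow> z \<le> x \<Longrightarrow> f z \<le> blinfun_ppart f x"
  by (subst blinfun_ppart_apply) (auto intro!: cSUP_upper bdd_above_blinfun_interval)

lemma blinfun_ppart_least: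
  fixes f g :: "'a::banach_lattice \<Rightarrow>\<^sub>L real"
  assumes "\<And>x. 0 \<le> x \<Longrightarrow> 0 \<le> g x" "\<And>x. 0 \<le> x \<Longrightarrow> f x \<le> g x" "0 \<le> x"
  shows "blinfun_ppart f x \<le> g x"
proof (subst blinfun_ppart_apply[OF assms(3)], rule cSUP_least)
  fix z assume "z \<in> {0..x}"
  then show "f z \<le> g x" using assms(2)[of z] blinfun_mono[of g z x] assms(1) by auto
qed (use assms in auto)

text \<open>The order lives on a copy of the dual space, because an instance for \<open>blinfun\<close> could not be
  restricted to the codomain \<open>real\<close>.\<close>

typedef (overloaded) 'a dual = "UNIV :: ('a::banach_lattice \<Rightarrow>\<^sub>L real) set"
  morphisms functional Dual ..

setup_lifting type_definition_dual

instantiation dual :: (banach_lattice) real_normed_vector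
begin

lift_definition norm_dual :: "'a dual \<Rightarrow> real" is norm .
lift_definition minus_dual :: "'a dual \<Rightarrow> 'a dual \<Rightarrow> 'a dual" is minus .
lift_definition plus_dual :: "'a dual \<Rightarrow> 'a dual \<Rightarrow> 'a dual" is plus .
lift_definition uminus_dual :: "'a dual \<Rightarrow> 'a dual" is uminus .
lift_definition zero_dual :: "'a dual" is 0 .
lift_definition scaleR_dual :: "real \<Rightarrow> 'a dual \<Rightarrow> 'a dual" is scaleR .
lift_definition sgn_dual :: "'a dual \<Rightarrow> 'a dual" is sgn .

definition dist_dual :: "'a dual \<Rightarrow> 'a dual \<Rightarrow> real" where
  "dist_dual a b = norm (a - b)"

definition uniformity_dual :: "('a dual \<times> 'a dual) filter" where
  "uniformity_dual = (INF e\<in>{0 <..}. principal {(x, y). dist x y < e})"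

definition open_dual :: "'a dual set \<Rightarrow> bool" where
  "open_dual S = (\<forall>x\<in>S. \<forall>\<^sub>F (x', y) in uniformity. x' = x \<longrightarrow> y \<in> S)"

instance
  by standard (unfold dist_dual_def open_dual_def uniformity_dual_def,
    (rule refl | (transfer, force simp: sgn_div_norm algebra_simps norm_triangle_ineq))+)

end

lemma functional_simps [simp]:
  "functional (f + g) = functional f + functional g"
  "functional (f - g) = functional f - functional g"
  "functional (- f) = - functional f"
  "functional (c *\<^sub>R f) = c *\<^sub>R functional f"
  "functional 0 = 0"
  "norm (functional f) = norm f"
  by (transfer; simp)+

lemma functional_Dual [simp]: "functional (Dual f) = f"
  by (simp add: Dual_inverse)

lemma norm_Dual: "norm (Dual f) = norm f"
  by (simp flip: functional_simps(6))

lemma functional_eqI: "functional f = functional g \<Longrightarrow> f = g"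
  by (simp add: functional_inject)

lemma bounded_linear_functional: "bounded_linear functional"
  by (rule bounded_linear_intro[of _ 1]) auto

lemma bounded_linear_Dual: "bounded_linear Dual"
  by (rule bounded_linear_intro[of _ 1]) (auto intro!: functional_eqI simp: norm_Dual)

instance dual :: (banach_lattice) banach
proof
  fix X :: "nat \<Rightarrow> 'a dual" assume X: "Cauchy X"
  then have "Cauchy (\<lambda>n. functional (X n))"
    by (rule bounded_linear.Cauchy[OF bounded_linear_functional])
  then obtain l where "(\<lambda>n. functional (X n)) \<longlonglongrightarrow> l"
    by (auto simp: Cauchy_convergent_iff convergent_def)
  then have "(\<lambda>n. Dual (functional (X n))) \<longlonglongrightarrow> Dual l"
    by (rule bounded_linear.tendsto[OF bounded_linear_Dual])
  then show "convergent X" by (auto simp: functional_inverse convergent_def)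
qed

instantiation dual :: (banach_lattice) lattice
begin

definition less_eq_dual :: "'a dual \<Rightarrow> 'a dual \<Rightarrow> bool" where
  "f \<le> g \<longleftrightarrow> (\<forall>x\<ge>0. functional f x \<le> functional g x)"

definition less_dual :: "'a dual \<Rightarrow> 'a dual \<Rightarrow> bool" where
  "(f :: 'a dual) < g \<longleftrightarrow> f \<le> g \<and> \<not> g \<le> f"

text \<open>The identities \<open>sup f g = g + (f - g)^+\<close> and
  \<open>inf f g = f - (f - g)^+\<close> reduce both operations to the positive part, so a single
  supremum formula carries the whole lattice structure.\<close>

definition sup_dual :: "'a dual \<Rightarrow> 'a dual \<Rightarrow> 'a dual" where
  "sup f g = g + Dual (blinfun_ppart (functional (f - g)))"

definition inf_dual :: "'a dual \<Rightarrow> 'a dual \<Rightarrow> 'a dual" where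
  "inf f g = f - Dual (blinfun_ppart (functional (f - g)))"

instance
proof
  fix f g h :: "'a dual"
  show "(f < g) = (f \<le> g \<and> \<not> g \<le> f)" by (simp add: less_dual_def)
  show "f \<le> f" by (simp add: less_eq_dual_def)
  show "f \<le> g \<Longrightarrow> g \<le> h \<Longrightarrow> f \<le> h" by (force simp: less_eq_dual_def)
  show "f \<le> g \<Longrightarrow> g \<le> f \<Longrightarrow> f = g"
    by (rule functional_eqI, rule blinfun_eq_on_cone) (force simp: less_eq_dual_def)
  show "f \<le> sup f g" "inf f g \<le> g"
    using blinfun_ppart_ge[of x x "functional (f - g)" for x]
    by (force simp: less_eq_dual_def sup_dual_def inf_dual_def blinfun.bilinear_simps)+
  show "g \<le> sup f g" "inf f g \<le> f"
    using blinfun_ppart_ge[of 0 x "functional (f - g)" for x]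
    by (force simp: less_eq_dual_def sup_dual_def inf_dual_def blinfun.bilinear_simps)+
  show "g \<le> f \<Longrightarrow> h \<le> f \<Longrightarrow> sup g h \<le> f"
    using blinfun_ppart_least[of "functional (f - h)" "functional (g - h)"]
    by (force simp: less_eq_dual_def sup_dual_def blinfun.bilinear_simps)
  show "f \<le> g \<Longrightarrow> f \<le> h \<Longrightarrow> f \<le> inf g h"
    using blinfun_ppart_least[of "functional (g - f)" "functional (g - h)"]
    by (force simp: less_eq_dual_def inf_dual_def blinfun.bilinear_simps)
qed

end

instance dual :: (banach_lattice) ordered_real_vector
  by standard (auto simp: less_eq_dual_def blinfun.bilinear_simps mult_left_mono mult_right_mono)

lemma cSUP_add_const:
  fixes f :: "'a \<Rightarrow> real"
  assumes "A \<noteq> {}" "bdd_above (f ` A)"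
  shows "(SUP x\<in>A. f x + c) = (SUP x\<in>A. f x) + c"
proof (rule antisym)
  show "(SUP x\<in>A. f x + c) \<le> (SUP x\<in>A. f x) + c"
    using assms by (intro cSUP_least) (auto intro: cSUP_upper)
  obtain M where "\<And>x. x \<in> A \<Longrightarrow> f x \<le> M" using assms(2) by (auto simp: bdd_above_def)
  then have bdd: "bdd_above ((\<lambda>x. f x + c) ` A)" by (intro bdd_aboveI2[of _ _ "M + c"]) auto
  have "(SUP x\<in>A. f x) \<le> (SUP x\<in>A. f x + c) - c"
    using assms cSUP_upper[OF _ bdd] by (intro cSUP_least) (auto simp: le_diff_eq)
  then show "(SUP x\<in>A. f x) + c \<le> (SUP x\<in>A. f x + c)" by simp
qed

lemma functional_sup:
  assumes "0 \<le> x"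
  shows "functional (sup f g) x = (SUP z\<in>{0..x}. functional f z + functional g (x - z))"
proof -
  have "(SUP z\<in>{0..x}. functional f z + functional g (x - z))
      = (SUP z\<in>{0..x}. functional (f - g) z + functional g x)"
    by (intro SUP_cong) (auto simp: blinfun.bilinear_simps)
  also have "\<dots> = (SUP z\<in>{0..x}. functional (f - g) z) + functional g x"
    using assms by (intro cSUP_add_const bdd_above_blinfun_interval) auto
  finally show ?thesis
    by (simp add: sup_dual_def blinfun.bilinear_simps blinfun_ppart_apply[OF assms])
qed

lemma functional_mono: "f \<le> g \<Longrightarrow> 0 \<le> x \<Longrightarrow> functional f x \<le> functional g x"
  by (simp add: less_eq_dual_def)

text \<open>The chain is \<open>|f x| \<le> |f| |x| \<le> |g| |x| \<le> norm g * norm x\<close>. Its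
  last step holds because \<open>|g| u\<close> is the supremum of \<open>g (z - (u - z))\<close>
  over \<open>z\<close> in \<open>[0, u]\<close>, and \<open>z - (u - z)\<close> stays in
  \<open>[- u, u]\<close>.\<close>

instance dual :: (banach_lattice) banach_lattice
proof
  fix f g :: "'a dual"
  assume le: "sup f (- f) \<le> sup g (- g)"
  have g: "functional (sup g (- g)) u \<le> norm g * norm u" if "0 \<le> u" for u
    unfolding functional_sup[OF that]
  proof (rule cSUP_least)
    fix z assume z: "z \<in> {0..u}"
    have "norm (z - (u - z)) \<le> norm u"
    proof (rule norm_mono_labs)
      have "z - (u - z) \<le> u" using z add_increasing2[of "u - z" z u] by (simp add: diff_le_eq)
      moreover have "- (z - (u - z)) \<le> u"
        using z add_increasing[of z "u - z" u] by (simp add: algebra_simps)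
      ultimately show "labs (z - (u - z)) \<le> labs u" using that by (simp add: labs_leI)
    qed
    have "functional g z + functional (- g) (u - z) = functional g (z - (u - z))"
      by (simp add: blinfun.bilinear_simps)
    also have "\<dots> \<le> norm g * norm (z - (u - z))"
      using norm_blinfun[of "functional g" "z - (u - z)"] by simp
    also have "\<dots> \<le> norm g * norm u"
      using \<open>norm (z - (u - z)) \<le> norm u\<close> by (intro mult_left_mono) auto
    finally show "functional g z + functional (- g) (u - z) \<le> norm g * norm u" .
  qed (use that in auto)
  have "norm (functional f) \<le> norm g"
  proof (rule norm_blinfun_bound)
    fix x :: 'a
    have m: "functional f x \<le> functional (sup f (- f)) (labs x)" for x
    proof -
      have 1: "functional f u \<le> functional (sup f (- f)) u" if "0 \<le> u" for u
        using functional_mono[OF sup.cobounded1 that, of f "- f"] .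
      have 2: "- functional f u \<le> functional (sup f (- f)) u" if "0 \<le> u" for u
        using functional_mono[OF sup.cobounded2 that, of "- f" f] by (simp add: blinfun.bilinear_simps)
      have "functional f x = functional f (ppart x) - functional f (npart x)"
        by (metis blinfun.diff_right ppart_minus_npart)
      also have "\<dots> \<le> functional (sup f (- f)) (ppart x) + functional (sup f (- f)) (npart x)"
        using 1[of "ppart x"] 2[of "npart x"] by simp
      finally show ?thesis unfolding labs_eq_parts blinfun.add_right .
    qed
    have "\<bar>functional f x\<bar> \<le> functional (sup f (- f)) (labs x)"
      using m[of x] m[of "- x"] by (simp add: blinfun.minus_right abs_le_iff)
    also have "\<dots> \<le> functional (sup g (- g)) (labs x)" by (rule functional_mono[OF le]) simp
    also have "\<dots> \<le> norm g * norm x" using g[of "labs x"] by simp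
    finally show "norm (functional f x) \<le> norm g * norm x" by simp
  qed simp
  then show "norm f \<le> norm g" by simp
qed

section \<open>Agreement of the pointwise formulas for functionals with the lattice operations of
  the dual\<close>

lemma functional_parts: "functional f y = functional f (ppart y) - functional f (npart y)"
  by (metis blinfun.diff_right ppart_minus_npart)

lemma dual_sup_functional:
  "dual_sup (blinfun_apply (functional f)) (blinfun_apply (functional g)) = functional (sup f g)"
proof
  fix y
  show "dual_sup (blinfun_apply (functional f)) (blinfun_apply (functional g)) y = functional (sup f g) y"
    unfolding dual_sup_def
    using functional_parts[of "sup f g" y] by (simp only: functional_sup ppart_nonneg npart_nonneg)
qed

lemma dual_inf_functional:
  "dual_inf (blinfun_apply (functional f)) (blinfun_apply (functional g)) = functional (inf f g)"
proof
  fix y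
  have inf: "functional (inf f g) x = (INF z\<in>{0..x}. functional f z + functional g (x - z))"
    if "0 \<le> x" for x
  proof -
    have "functional (inf f g) x = - functional (sup (- f) (- g)) x"
      by (simp only: inf_eq_neg_sup[of f g] functional_simps blinfun.minus_left)
    also have "\<dots> = - (SUP z\<in>{0..x}. - (functional f z + functional g (x - z)))"
      unfolding functional_sup[OF that] by (simp add: blinfun.bilinear_simps)
    finally show ?thesis by (simp only: Inf_real_def image_image)
  qed
  show "dual_inf (blinfun_apply (functional f)) (blinfun_apply (functional g)) y = functional (inf f g) y"
    unfolding dual_inf_def
    using functional_parts[of "inf f g" y] by (simp only: inf ppart_nonneg npart_nonneg)
qed

lemma dual_abs_blinfun: "dual_abs (blinfun_apply f) = functional (labs (Dual f))"
  unfolding dual_abs_def labs_def dual_sup_functional[symmetric]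
  by (simp add: blinfun.minus_left[abs_def])

lemma dual_ppart_functional: "dual_ppart (blinfun_apply (functional f)) = functional (ppart f)"
  unfolding dual_ppart_def ppart_def dual_sup_functional[symmetric]
  by (simp add: zero_blinfun.rep_eq)

lemma dual_nonneg_functional: "dual_nonneg (blinfun_apply (functional g)) \<longleftrightarrow> 0 \<le> g"
  by (simp add: dual_nonneg_def less_eq_dual_def)

lemma dual_disjoint_seq_functional:
  "dual_disjoint_seq (\<lambda>n. functional (g n)) \<longleftrightarrow> disjoint_seq g"
proof -
  have "dual_inf (dual_abs (functional a)) (dual_abs (functional b)) = (\<lambda>y. 0)
      \<longleftrightarrow> inf (labs a) (labs b) = 0" for a b :: "'a dual"
    unfolding dual_abs_blinfun functional_inverse dual_inf_functional
    by (auto intro!: functional_eqI blinfun_eqI simp: fun_eq_iff)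
  then show ?thesis by (simp add: dual_disjoint_seq_def disjoint_seq_def)
qed

subsection \<open>Components of positive functionals\<close>

text \<open>The component of a positive functional \<open>\<phi>\<close> carried by the band generated by \<open>v\<close>.\<close>

definition band_component :: "('a::banach_lattice \<Rightarrow>\<^sub>L real) \<Rightarrow> 'a \<Rightarrow> 'a \<Rightarrow>\<^sub>L real" where
  "band_component \<phi> v = cone_extension (\<lambda>x. SUP k::nat. \<phi> (inf x (real k *\<^sub>R v)))"

context
  fixes \<phi> :: "'a::banach_lattice \<Rightarrow>\<^sub>L real" and v :: 'a
  assumes pos: "\<And>x. 0 \<le> x \<Longrightarrow> 0 \<le> \<phi> x" and v: "0 \<le> v"
begin

lemma inf_multiple_LIMSEQ_SUP:
  assumes "0 \<le> x"
  shows "(\<lambda>k::nat. \<phi> (inf x (real k *\<^sub>R v))) \<longlonglongrightarrow> (SUP k::nat. \<phi> (inf x (real k *\<^sub>R v)))"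
proof (rule LIMSEQ_incseq_SUP)
  show "bdd_above (range (\<lambda>k::nat. \<phi> (inf x (real k *\<^sub>R v))))"
    by (intro bdd_aboveI2[of _ _ "\<phi> x"] blinfun_mono pos) auto
  show "incseq (\<lambda>k::nat. \<phi> (inf x (real k *\<^sub>R v)))"
    using v by (intro incseq_SucI blinfun_mono pos inf_mono scaleR_right_mono) auto
qed

text \<open>Additivity comes in the limit from \<open>inf (x + y) (k v) \<le> inf x (k v) + inf y (k
  v) \<le> inf (x + y) (2 k v)\<close>; the factor 2 only passes to a subsequence.\<close>

lemma band_component_apply:
  assumes "0 \<le> x"
  shows "band_component \<phi> v x = (SUP k::nat. \<phi> (inf x (real k *\<^sub>R v)))"
  unfolding band_component_def
proof (rule cone_extension_apply[OF _ _ assms])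
  fix x :: 'a assume "0 \<le> x"
  then show "0 \<le> (SUP k::nat. \<phi> (inf x (real k *\<^sub>R v)))"
    by (intro LIMSEQ_le_const[OF inf_multiple_LIMSEQ_SUP])
      (auto intro!: pos simp: v scaleR_nonneg_nonneg)
next
  fix x y :: 'a assume xy: "0 \<le> x" "0 \<le> y"
  let ?L = "\<lambda>x. SUP k::nat. \<phi> (inf x (real k *\<^sub>R v))"
  note lx = inf_multiple_LIMSEQ_SUP[OF xy(1)] and ly = inf_multiple_LIMSEQ_SUP[OF xy(2)]
    and lxy = inf_multiple_LIMSEQ_SUP[OF add_nonneg_nonneg[OF xy]]
  show "?L (x + y) = ?L x + ?L y"
  proof (rule antisym)
    show "?L (x + y) \<le> ?L x + ?L y"
    proof (rule LIMSEQ_le[OF lxy tendsto_add[OF lx ly]], intro exI allI impI)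
      fix k :: nat
      have "\<phi> (inf (x + y) (real k *\<^sub>R v)) \<le> \<phi> (inf x (real k *\<^sub>R v) + inf y (real k *\<^sub>R v))"
        using xy v by (intro blinfun_mono pos inf_add_le) (auto simp: scaleR_nonneg_nonneg)
      then show "\<phi> (inf (x + y) (real k *\<^sub>R v)) \<le> \<phi> (inf x (real k *\<^sub>R v)) + \<phi> (inf y (real k *\<^sub>R v))"
        by (simp add: blinfun.add_right)
    qed
    have "strict_mono (\<lambda>k::nat. 2 * k)" by (simp add: strict_mono_def)
    from LIMSEQ_subseq_LIMSEQ[OF lxy this]
    have l2: "(\<lambda>k::nat. \<phi> (inf (x + y) (real (2 * k) *\<^sub>R v))) \<longlonglongrightarrow> ?L (x + y)"
      by (simp only: o_def)
    show "?L x + ?L y \<le> ?L (x + y)"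
    proof (rule LIMSEQ_le[OF tendsto_add[OF lx ly] l2], intro exI allI impI)
      fix k :: nat
      have "real (2 * k) *\<^sub>R v = real k *\<^sub>R v + real k *\<^sub>R v"
        by (metis mult_2 of_nat_add scaleR_add_left)
      then have "\<phi> (inf x (real k *\<^sub>R v) + inf y (real k *\<^sub>R v)) \<le> \<phi> (inf (x + y) (real (2 * k) *\<^sub>R v))"
        by (intro blinfun_mono pos) (auto intro: add_mono)
      then show "\<phi> (inf x (real k *\<^sub>R v)) + \<phi> (inf y (real k *\<^sub>R v)) \<le> \<phi> (inf (x + y) (real (2 * k) *\<^sub>R v))"
        by (simp add: blinfun.add_right)
    qed
  qed
qed

lemma band_component_LIMSEQ:
  "0 \<le> x \<Longrightarrow> (\<lambda>k::nat. \<phi> (inf x (real k *\<^sub>R v))) \<longlonglongrightarrow> band_component \<phi> v x"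
  using inf_multiple_LIMSEQ_SUP band_component_apply by simp

lemma band_component_nonneg: "0 \<le> x \<Longrightarrow> 0 \<le> band_component \<phi> v x"
  by (intro LIMSEQ_le_const[OF band_component_LIMSEQ])
    (auto intro!: pos simp: v scaleR_nonneg_nonneg)

lemma band_component_le: "0 \<le> x \<Longrightarrow> band_component \<phi> v x \<le> \<phi> x"
  by (intro LIMSEQ_le_const2[OF band_component_LIMSEQ]) (auto intro!: blinfun_mono pos)

lemma band_component_self: "band_component \<phi> v v = \<phi> v"
proof (rule antisym[OF band_component_le[OF v]])
  have "\<phi> v \<le> \<phi> (inf v (real k *\<^sub>R v))" if "k \<ge> 1" for k
    using scaleR_right_mono[of 1 "real k" v] that v by (intro blinfun_mono pos) auto
  then show "\<phi> v \<le> band_component \<phi> v v" by (intro LIMSEQ_le_const[OF band_component_LIMSEQ[OF v]]) auto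
qed

lemma band_component_disjoint:
  assumes "0 \<le> w" "inf v w = 0"
  shows "band_component \<phi> v w = 0"
proof -
  have "inf w (real k *\<^sub>R v) = 0" for k using inf_scaleR_zero[OF v assms] by (simp add: inf.commute)
  then have "(\<lambda>k::nat. 0) \<longlonglongrightarrow> band_component \<phi> v w" using band_component_LIMSEQ[OF assms(1)] by simp
  then show ?thesis by (simp add: LIMSEQ_const_iff)
qed

end

text \<open>The witness is \<open>c\<^sub>1 - c\<^sub>2\<close>, where \<open>c\<^sub>1\<close> is the component of \<open>c\<close> on the band of \<open>y\<^sup>+\<close>
  and \<open>c\<^sub>2 = c - c\<^sub>1\<close>.\<close>

lemma functional_attaining_modulus:
  fixes c :: "'a::banach_lattice \<Rightarrow>\<^sub>L real"
  assumes pos: "\<And>x. 0 \<le> x \<Longrightarrow> 0 \<le> c x"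
  obtains k where "blinfun_apply k y = c (labs y)" "\<And>x. \<bar>blinfun_apply k x\<bar> \<le> c (labs x)"
proof
  define d where "d = band_component c (ppart y)"
  have d: "0 \<le> d x" "d x \<le> c x" if "0 \<le> x" for x
    unfolding d_def using that pos by (auto intro!: band_component_nonneg band_component_le)
  have dy: "d (ppart y) = c (ppart y)" "d (npart y) = 0"
    unfolding d_def using pos by (auto intro!: band_component_self band_component_disjoint inf_ppart_npart)
  define k where "k = 2 *\<^sub>R d - c"
  have split: "blinfun_apply f x = f (ppart x) - f (npart x)" for f :: "'a \<Rightarrow>\<^sub>L real" and x
    by (metis blinfun.diff_right ppart_minus_npart)
  show "k y = c (labs y)"
    unfolding split[of k y] labs_eq_parts using dy by (simp add: k_def blinfun.bilinear_simps)
  fix x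
  have "\<bar>k u\<bar> \<le> c u" if "0 \<le> u" for u
    using d[OF that] by (simp add: k_def blinfun.bilinear_simps abs_le_iff)
  from this[of "ppart x"] this[of "npart x"] show "\<bar>k x\<bar> \<le> c (labs x)"
    unfolding split[of k x] labs_eq_parts blinfun.add_right by simp
qed

text \<open>Weak compactness will be known for the \<open>y n\<close>, while \<open>v n\<close> is
  only below \<open>|y n|\<close>; this is the bridge. With \<open>c n\<close> the component of
  \<open>\<phi>\<close> on the band of \<open>v n\<close>, and \<open>k n\<close> a functional with
  \<open>k n (y n) = c n |y n|\<close>, one has
  \<open>\<phi> (v n) = c n (v n) \<le> k n (y n)\<close>. The sums are bounded because, for each
  \<open>j\<close>, the truncations \<open>inf |x| (j v n)\<close> are disjoint elements below
  \<open>|x|\<close>, so \<open>\<phi>\<close> sums them to at most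
  \<open>\<phi> |x|\<close>.\<close>

lemma disjoint_functionals:
  fixes \<phi> :: "'a::banach_lattice \<Rightarrow>\<^sub>L real"
  assumes pos: "\<And>x. 0 \<le> x \<Longrightarrow> 0 \<le> \<phi> x"
    and v: "\<And>n. 0 \<le> v n" "disjoint_seq v" "\<And>n. v n \<le> labs (y n)"
  obtains k where "\<And>n. \<phi> (v n) \<le> blinfun_apply (k n) (y n)"
    "\<And>N x. (\<Sum>n<N. \<bar>blinfun_apply (k n) x\<bar>) \<le> norm \<phi> * norm x"
proof -
  define c where "c n = band_component \<phi> (v n)" for n
  have c0: "0 \<le> c n x" if "0 \<le> x" for n x
    unfolding c_def by (rule band_component_nonneg[OF pos v(1) that])
  have "\<exists>k. blinfun_apply k (y n) = c n (labs (y n)) \<and> (\<forall>x. \<bar>blinfun_apply k x\<bar> \<le> c n (labs x))" for n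
    using functional_attaining_modulus[OF c0] by metis
  then obtain k where k: "\<And>n. blinfun_apply (k n) (y n) = c n (labs (y n))"
    "\<And>n x. \<bar>blinfun_apply (k n) x\<bar> \<le> c n (labs x)"
    by metis
  show thesis
  proof
    fix n
    have "\<phi> (v n) = c n (v n)" unfolding c_def by (rule band_component_self[OF pos v(1), symmetric])
    also have "\<dots> \<le> c n (labs (y n))" by (rule blinfun_mono[OF c0 v(3)])
    finally show "\<phi> (v n) \<le> k n (y n)" by (simp add: k)
  next
    fix N x
    have "(\<Sum>n<N. \<bar>k n x\<bar>) \<le> (\<Sum>n<N. c n (labs x))" by (intro sum_mono k)
    also have "\<dots> \<le> \<phi> (labs x)"
    proof (rule LIMSEQ_le_const2)
      show "(\<lambda>j::nat. \<Sum>n<N. \<phi> (inf (labs x) (real j *\<^sub>R v n))) \<longlonglongrightarrow> (\<Sum>n<N. c n (labs x))"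
        unfolding c_def by (intro tendsto_sum band_component_LIMSEQ[OF pos v(1)]) auto
      have "(\<Sum>n<N. \<phi> (inf (labs x) (real j *\<^sub>R v n))) \<le> \<phi> (labs x)" for j :: nat
      proof -
        have "(\<Sum>n<N. inf (labs x) (real j *\<^sub>R v n)) \<le> labs x"
        proof (rule sum_disjoint_le)
          fix m n :: nat assume "m \<noteq> n"
          then have "inf (v m) (v n) = 0" using v(1,2) by (simp add: disjoint_seq_def)
          then have "inf (real j *\<^sub>R v m) (real j *\<^sub>R v n) = 0"
            by (metis inf.commute inf_scaleR_zero of_nat_0_le_iff scaleR_nonneg_nonneg v(1))
          then show "inf (inf (labs x) (real j *\<^sub>R v m)) (inf (labs x) (real j *\<^sub>R v n)) = 0"
            by (rule inf_zero_mono[rotated -1]) (auto simp: v scaleR_nonneg_nonneg)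
        qed (auto simp: v scaleR_nonneg_nonneg)
        from blinfun_mono[OF pos this] show ?thesis by (simp add: blinfun.sum_right)
      qed
      then show "\<exists>j0. \<forall>j\<ge>j0. (\<Sum>n<N. \<phi> (inf (labs x) (real j *\<^sub>R v n))) \<le> \<phi> (labs x)" by blast
    qed
    also have "\<dots> \<le> norm \<phi> * norm x" using norm_blinfun[of \<phi> "labs x"] by simp
    finally show "(\<Sum>n<N. \<bar>k n x\<bar>) \<le> norm \<phi> * norm x" .
  qed
qed

subsection \<open>Norming functionals and uniform boundedness\<close>

text \<open>Homogeneity is required only as an inequality, which is easier to verify for infima;
  scaling back by \<open>1 / c\<close> turns it into an equality.\<close>

definition sublinear :: "('a::real_vector \<Rightarrow> real) \<Rightarrow> bool" where
  "sublinear q \<longleftrightarrow> (\<forall>x y. q (x + y) \<le> q x + q y) \<and> (\<forall>c x. 0 \<le> c \<longrightarrow> q (c *\<^sub>R x) \<le> c * q x)"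

lemma sublinear_add: "sublinear q \<Longrightarrow> q (x + y) \<le> q x + q y"
  by (simp add: sublinear_def)

lemma sublinear_zero: "sublinear q \<Longrightarrow> q 0 = 0"
  unfolding sublinear_def
  by (rule antisym) (metis mult_zero_left order_refl scaleR_zero_left, metis add_0 le_add_same_cancel1)

lemma sublinear_scaleR:
  assumes "sublinear q" "0 \<le> c"
  shows "q (c *\<^sub>R x) = c * q x"
proof (cases "c = 0")
  case False
  then have c: "c > 0" using assms by simp
  have "q ((1 / c) *\<^sub>R (c *\<^sub>R x)) \<le> (1 / c) * q (c *\<^sub>R x)"
    using assms(1) c unfolding sublinear_def by (meson divide_nonneg_pos zero_le_one)
  then have "c * q x \<le> q (c *\<^sub>R x)" using c by (simp add: field_simps)
  moreover have "q (c *\<^sub>R x) \<le> c * q x" using assms by (simp add: sublinear_def)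
  ultimately show ?thesis by simp
qed (use assms sublinear_zero in auto)

lemma sublinear_ge_minus: "sublinear q \<Longrightarrow> - q (- x) \<le> q x"
  using sublinear_add[of q x "- x"] sublinear_zero[of q] by simp

text \<open>\<open>q'\<close> is the largest sublinear functional below \<open>q\<close> with
  \<open>q' (- y) \<le> - q y\<close>, that is, \<open>q\<close> lowered until it is forced to be
  linear along \<open>y\<close>. The infimum is finite because subadditivity bounds it below by
  \<open>- q (- x)\<close>.\<close>

lemma sublinear_INF_shift:
  fixes q :: "'a::real_vector \<Rightarrow> real" and y :: 'a
  assumes q: "sublinear q"
    and q'_def: "\<And>x. q' x = (INF t\<in>{0..}. q (x + t *\<^sub>R y) - t * q y)"
  shows "sublinear q'" and "\<And>t x. 0 \<le> t \<Longrightarrow> q' x \<le> q (x + t *\<^sub>R y) - t * q y"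
proof -
  have bdd: "bdd_below ((\<lambda>t. q (x + t *\<^sub>R y) - t * q y) ` {0..})" for x
  proof (rule bdd_belowI2)
    fix t :: real assume "t \<in> {0..}"
    then have "t * q y = q ((x + t *\<^sub>R y) + (- x))" using sublinear_scaleR[OF q, of t y] by simp
    also have "\<dots> \<le> q (x + t *\<^sub>R y) + q (- x)" by (rule sublinear_add[OF q])
    finally show "- q (- x) \<le> q (x + t *\<^sub>R y) - t * q y" by simp
  qed
  show lower: "q' x \<le> q (x + t *\<^sub>R y) - t * q y" if "0 \<le> t" for t x
    unfolding q'_def by (rule cINF_lower[OF bdd]) (use that in auto)
  show "sublinear q'"
    unfolding sublinear_def
  proof (intro conjI allI impI)
    fix a b
    have "q' (a + b) - q' b \<le> q (a + t *\<^sub>R y) - t * q y" if t: "0 \<le> t" for t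
    proof -
      have "q' (a + b) - (q (a + t *\<^sub>R y) - t * q y) \<le> q (b + s *\<^sub>R y) - s * q y" if s: "0 \<le> s" for s
      proof -
        have "q' (a + b) \<le> q ((a + b) + (t + s) *\<^sub>R y) - (t + s) * q y"
          using s t by (intro lower) simp
        also have "(a + b) + (t + s) *\<^sub>R y = (a + t *\<^sub>R y) + (b + s *\<^sub>R y)" by (simp add: algebra_simps)
        finally show ?thesis using sublinear_add[OF q, of "a + t *\<^sub>R y" "b + s *\<^sub>R y"] 
          by (simp add: algebra_simps)
      qed
      then have "q' (a + b) - (q (a + t *\<^sub>R y) - t * q y) \<le> q' b"
        unfolding q'_def[of b] by (intro cINF_greatest) auto
      then show ?thesis by simp
    qed
    then have "q' (a + b) - q' b \<le> q' a"
      unfolding q'_def[of a] by (intro cINF_greatest) auto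
    then show "q' (a + b) \<le> q' a + q' b" by simp
  next
    fix c :: real and x assume "0 \<le> c"
    show "q' (c *\<^sub>R x) \<le> c * q' x"
    proof (cases "c = 0")
      case True
      then show ?thesis using lower[of 0 0] sublinear_zero[OF q] by simp
    next
      case False
      then have c: "c > 0" using \<open>0 \<le> c\<close> by simp
      have "q' (c *\<^sub>R x) / c \<le> q (x + t *\<^sub>R y) - t * q y" if t: "0 \<le> t" for t
      proof -
        have "q' (c *\<^sub>R x) \<le> q (c *\<^sub>R x + (c * t) *\<^sub>R y) - (c * t) * q y"
          using c t by (intro lower) simp
        also have "c *\<^sub>R x + (c * t) *\<^sub>R y = c *\<^sub>R (x + t *\<^sub>R y)" by (simp add: algebra_simps)
        also have "q \<dots> = c * q (x + t *\<^sub>R y)" using sublinear_scaleR[OF q] c by simp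
        finally show ?thesis using c by (simp add: field_simps)
      qed
      then have "q' (c *\<^sub>R x) / c \<le> q' x"
        unfolding q'_def[of x] by (intro cINF_greatest) auto
      then show ?thesis using c by (simp add: field_simps)
    qed
  qed
qed

text \<open>The bound \<open>- p (- x)\<close> keeps the infimum finite. Subadditivity needs the
  chain: of two members used at \<open>x\<close> and at \<open>y\<close>, the smaller one serves for
  both.\<close>

lemma sublinear_INF_chain:
  fixes p :: "'a::real_vector \<Rightarrow> real"
  assumes C: "C \<noteq> {}" "\<And>q. q \<in> C \<Longrightarrow> sublinear q \<and> q \<le> p"
    and chain: "\<And>q r. q \<in> C \<Longrightarrow> r \<in> C \<Longrightarrow> q \<le> r \<or> r \<le> q"
    and m_def: "\<And>x. m x = (INF q\<in>C. q x)"
  shows "sublinear m" and "\<And>q. q \<in> C \<Longrightarrow> m \<le> q"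
proof -
  have bdd: "bdd_below ((\<lambda>q. q x) ` C)" for x
  proof (rule bdd_belowI2)
    fix q assume "q \<in> C"
    then have "sublinear q" "q (- x) \<le> p (- x)" using C by (auto simp: le_fun_def)
    then show "- p (- x) \<le> q x" using sublinear_ge_minus[of q x] by simp
  qed
  have lower: "m x \<le> q x" if "q \<in> C" for q x
    unfolding m_def by (rule cINF_lower[OF bdd that])
  then show "\<And>q. q \<in> C \<Longrightarrow> m \<le> q" by (simp add: le_fun_def)
  show "sublinear m"
    unfolding sublinear_def
  proof (intro conjI allI impI)
    fix x y
    have "m (x + y) \<le> q x + r y" if qr: "q \<in> C" "r \<in> C" for q r
    proof -
      obtain s where s: "s \<in> C" "s \<le> q" "s \<le> r" using chain[OF qr] qr by blast
      have "m (x + y) \<le> s (x + y)" using lower s by blast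
      also have "\<dots> \<le> s x + s y" using C s by (simp add: sublinear_add)
      also have "\<dots> \<le> q x + r y" using s by (simp add: add_mono le_funD)
      finally show ?thesis .
    qed
    then have "m (x + y) - q x \<le> m y" if "q \<in> C" for q
      unfolding m_def[of y] using that C(1) by (intro cINF_greatest) (auto simp: diff_le_eq add.commute[of _ "q x"])
    then have "m (x + y) - m y \<le> m x"
      unfolding m_def[of x] using C(1) by (intro cINF_greatest) (auto simp: diff_le_eq add.commute[of _ "m y"])
    then show "m (x + y) \<le> m x + m y" by simp
  next
    fix c :: real and x assume c: "0 \<le> c"
    show "m (c *\<^sub>R x) \<le> c * m x"
    proof (cases "c = 0")
      case True
      obtain q where "q \<in> C" using C(1) by auto
      then have "m 0 \<le> 0" using lower[of q 0] C(2)[of q] sublinear_zero[of q] by simp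
      then show ?thesis using True by simp
    next
      case False
      then have "c > 0" using c by simp
      have "m (c *\<^sub>R x) / c \<le> q x" if "q \<in> C" for q
        using lower[OF that, of "c *\<^sub>R x"] sublinear_scaleR[of q c x] C(2)[OF that] \<open>c > 0\<close>
        by (simp add: field_simps)
      then have "m (c *\<^sub>R x) / c \<le> m x"
        unfolding m_def[of x] using C(1) by (intro cINF_greatest) auto
      then show ?thesis using \<open>c > 0\<close> by (simp add: field_simps)
    qed
  qed
qed

text \<open>A minimal sublinear functional is linear, since it cannot be lowered by
  \<open>sublinear_INF_shift\<close>; this gives the Hahn--Banach theorem by Zorn's lemma.\<close>

lemma sublinear_dominates_linear:
  fixes p :: "'a::real_vector \<Rightarrow> real"
  assumes p: "sublinear p"
  shows "\<exists>f. linear f \<and> f \<le> p"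
proof -
  define Q where "Q = {q. sublinear q \<and> q \<le> p}"
  have "\<exists>m\<in>Q. \<forall>a\<in>Q. a \<le> m \<longrightarrow> a = m"
  proof (rule predicate_Zorn)
    show "partial_order_on Q (relation_of (\<lambda>a b. b \<le> a) Q)"
      by (rule partial_order_on_relation_ofI) auto
    fix C assume C: "C \<in> Chains (relation_of (\<lambda>a b. b \<le> a) Q)"
    then have CQ: "C \<subseteq> Q" and ch: "\<And>q r. q \<in> C \<Longrightarrow> r \<in> C \<Longrightarrow> q \<le> r \<or> r \<le> q"
      by (auto simp: Chains_def relation_of_def)
    show "\<exists>u\<in>Q. \<forall>a\<in>C. u \<le> a"
    proof (cases "C = {}")
      case True
      then show ?thesis using p by (auto simp: Q_def)
    next
      case False
      define m where "m x = (INF q\<in>C. q x)" for x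
      have sp: "\<And>q. q \<in> C \<Longrightarrow> sublinear q \<and> q \<le> p" using CQ by (auto simp: Q_def)
      note m = sublinear_INF_chain[of C p, OF False sp ch m_def]
      obtain q where "q \<in> C" using False by auto
      then have "m \<le> p" using m(2) sp order_trans by blast
      then show ?thesis using m by (intro bexI[of _ m]) (auto simp: Q_def)
    qed
  qed
  then obtain m where m: "sublinear m" "m \<le> p" and min: "\<And>a. sublinear a \<Longrightarrow> a \<le> m \<Longrightarrow> a = m"
    unfolding Q_def using order_trans by blast
  have add: "m (x + y) = m x + m y" for x y
  proof -
    define q' where "q' x = (INF t\<in>{0..}. m (x + t *\<^sub>R y) - t * m y)" for x
    note q' = sublinear_INF_shift[OF m(1) q'_def]
    have "q' \<le> m" using q'(2)[of 0] by (auto simp: le_fun_def)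
    then have "q' = m" using min q'(1) by blast
    then have "m x \<le> m (x + y) - m y" using q'(2)[of 1 x] by simp
    then show ?thesis using sublinear_add[OF m(1), of x y] by simp
  qed
  have neg: "m (- x) = - m x" for x using add[of x "- x"] sublinear_zero[OF m(1)] by simp
  have "linear m"
  proof (rule linearI)
    fix c x
    show "m (c *\<^sub>R x) = c *\<^sub>R m x"
      using sublinear_scaleR[OF m(1), of c x] sublinear_scaleR[OF m(1), of "- c" x] neg[of "c *\<^sub>R x"]
      by (cases "0 \<le> c") auto
  qed (rule add)
  then show ?thesis using m by blast
qed

text \<open>No extension from a subspace is needed: lowering the norm along \<open>x\<close> first
  gives a sublinear \<open>p\<close> with \<open>p (- x) \<le> - norm x\<close>, and any linear
  functional below \<open>p\<close> then attains the norm at \<open>x\<close>.\<close>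

lemma norming_functional:
  fixes x :: "'a::real_normed_vector"
  shows "\<exists>\<phi>::'a \<Rightarrow>\<^sub>L real. norm \<phi> \<le> 1 \<and> blinfun_apply \<phi> x = norm x"
proof -
  have n: "sublinear (norm :: 'a \<Rightarrow> real)" by (simp add: sublinear_def norm_triangle_ineq)
  define p where "p z = (INF t\<in>{0..}. norm (z + t *\<^sub>R x) - t * norm x)" for z
  note p = sublinear_INF_shift[OF n p_def]
  obtain f where f: "linear f" "f \<le> p" using sublinear_dominates_linear[OF p(1)] by blast
  have le: "f z \<le> norm z" for z using f(2) p(2)[of 0 z] le_funD[of f p z] by simp
  have abs: "\<bar>f z\<bar> \<le> norm z" for z using le[of z] le[of "- z"] linear_neg[OF f(1), of z] by simp
  have "f (- x) \<le> - norm x" using le_funD[OF f(2), of "- x"] p(2)[of 1 "- x"] by simp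
  then have fx: "f x = norm x" using le[of x] linear_neg[OF f(1), of x] by simp
  have bl: "bounded_linear f"
    by (rule bounded_linear_intro[of _ 1])
      (use abs linear_add[OF f(1)] linear_scale[OF f(1)] in auto)
  show ?thesis
    using abs fx by (intro exI[of _ "Blinfun f"])
      (auto simp: bounded_linear_Blinfun_apply[OF bl] intro!: norm_blinfun_bound)
qed

text \<open>Gliding hump: were \<open>A\<close> unbounded, a series of norming functionals with suitable signs
  would be unbounded on \<open>A\<close>.\<close>

lemma weakly_bounded_imp_bounded:
  fixes A :: "'a::real_normed_vector set"
  assumes "\<And>\<phi>::'a \<Rightarrow>\<^sub>L real. bounded (\<phi> ` A)"
  shows "bounded A"
proof (rule ccontr)
  assume "\<not> bounded A"
  then have "\<exists>x\<in>A. norm x \<ge> 4 ^ n" for n :: nat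
    unfolding bounded_iff by (meson linear)
  then obtain x where x: "\<And>n. x n \<in> A" "\<And>n. norm (x n) \<ge> 4 ^ n" by metis
  obtain \<xi> :: "nat \<Rightarrow> 'a \<Rightarrow>\<^sub>L real" where \<xi>: "\<And>n. norm (\<xi> n) \<le> 1" "\<And>n. \<xi> n (x n) = norm (x n)"
    using norming_functional[of "x _"] by metis
  \<comment> \<open>The sign keeps the new term from cancelling the value of the previous sum at
    \<open>x n\<close>. With ratio 1/3 the later terms have total norm at most half of
    \<open>(1/3) ^ n\<close>, so half of the hump survives; against
    \<open>norm (x n) \<ge> 4 ^ n\<close> it grows like \<open>(4/3) ^ n / 2\<close>.\<close>
  define \<phi> where "\<phi> = rec_nat (0 :: 'a \<Rightarrow>\<^sub>L real)
    (\<lambda>n f. f + ((if blinfun_apply f (x n) \<ge> 0 then 1 else - 1) * (1/3) ^ n) *\<^sub>R \<xi> n)"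
  define d where "d n = \<phi> (Suc n) - \<phi> n" for n
  have d: "d n = ((if \<phi> n (x n) \<ge> 0 then 1 else - 1) * (1/3) ^ n) *\<^sub>R \<xi> n" for n
    by (simp add: d_def \<phi>_def)
  have \<phi>0: "\<phi> 0 = 0" by (simp add: \<phi>_def)
  have nd: "norm (d n) \<le> (1/3) ^ n" for n using \<xi>(1)[of n] by (simp add: d mult_left_le)
  have sm: "summable d" by (rule summable_comparison_test'[of "\<lambda>n. (1/3) ^ n"]) (use nd in auto)
  have \<phi>sum: "\<phi> n = (\<Sum>i<n. d i)" for n by (simp add: d_def sum_lessThan_telescope \<phi>0)
  define \<psi> where "\<psi> = suminf d"
  have tail: "norm (\<psi> - \<phi> (Suc n)) \<le> (1/3) ^ n / 2" for n
  proof -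
    have "\<psi> - \<phi> (Suc n) = (\<Sum>i. d (i + Suc n))"
      unfolding \<psi>_def \<phi>sum using suminf_minus_initial_segment[OF sm, of "Suc n"] by simp
    also have "norm \<dots> \<le> (\<Sum>i. (1/3) ^ (i + Suc n))"
      by (rule norm_suminf_le) (auto intro!: nd summable_ignore_initial_segment simp del: add_Suc_right)
    also have "\<dots> = (\<Sum>i. (1/3) ^ Suc n * (1/3) ^ i)" by (simp add: power_add mult.commute)
    also have "\<dots> = (1/3) ^ Suc n * (\<Sum>i. (1/3) ^ i)" by (intro suminf_mult) auto
    also have "\<dots> = (1/3) ^ n / 2" by (subst suminf_geometric) auto
    finally show ?thesis .
  qed
  have hump: "\<bar>\<phi> (Suc n) (x n)\<bar> \<ge> (1/3) ^ n * norm (x n)" for n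
  proof -
    have "\<phi> (Suc n) (x n) = \<phi> n (x n) + d n (x n)" by (simp add: d_def blinfun.diff_left)
    moreover have "d n (x n) = (if \<phi> n (x n) \<ge> 0 then 1 else - 1) * (1/3) ^ n * norm (x n)"
      unfolding d by (simp add: blinfun.scaleR_left \<xi>)
    moreover have "(1/3) ^ n * norm (x n) \<ge> 0" by simp
    ultimately show ?thesis by (auto split: if_splits)
  qed
  have big: "\<bar>\<psi> (x n)\<bar> \<ge> (4/3) ^ n / 2" for n
  proof -
    have "\<bar>(\<psi> - \<phi> (Suc n)) (x n)\<bar> \<le> norm (\<psi> - \<phi> (Suc n)) * norm (x n)"
      using norm_blinfun[of "\<psi> - \<phi> (Suc n)" "x n"] by simp
    also have "\<dots> \<le> (1/3) ^ n / 2 * norm (x n)" using tail by (intro mult_right_mono) auto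
    finally have "\<bar>\<psi> (x n)\<bar> \<ge> (1/3) ^ n / 2 * norm (x n)"
      using hump[of n] unfolding blinfun.diff_left by linarith
    moreover have "(1/3) ^ n / 2 * norm (x n) \<ge> (1/3) ^ n / 2 * 4 ^ n"
      using x(2)[of n] by (intro mult_left_mono) auto
    moreover have "(1/3) ^ n / 2 * 4 ^ n = (4/3 :: real) ^ n / 2" by (simp add: power_divide)
    ultimately show ?thesis by linarith
  qed
  obtain B where B: "\<And>n. \<bar>\<psi> (x n)\<bar> \<le> B" using assms[of \<psi>] x(1) by (auto simp: bounded_iff)
  obtain n where "2 * B < (4/3) ^ n" using real_arch_pow[of "4/3" "2 * B"] by auto
  then show False using big[of n] B[of n] by simp
qed

subsection \<open>Relatively weakly compact sets\<close>

lemma openin_weak_preimage: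
  fixes \<phi> :: "'a::real_normed_vector \<Rightarrow>\<^sub>L real"
  assumes "open U"
  shows "openin weak_topology {x. \<phi> x \<in> U}"
  unfolding weak_topology_def by (rule topology_generated_by_Basis) (use assms in blast)

lemma topspace_weak [simp]: "topspace (weak_topology :: 'a::real_normed_vector topology) = UNIV"
  using openin_subset[OF openin_weak_preimage[of UNIV 0]] by auto

lemma subset_weak_closure: "A \<subseteq> weak_topology closure_of A"
  by (rule closure_of_subset) simp

lemma rel_weakly_compact_imp_bounded:
  fixes A :: "'a::real_normed_vector set"
  assumes "rel_weakly_compact A"
  shows "bounded A"
proof (rule weakly_bounded_imp_bounded)
  fix \<phi> :: "'a \<Rightarrow>\<^sub>L real"
  have "continuous_map weak_topology euclidean (blinfun_apply \<phi>)"
    by (auto simp: continuous_map_def openin_weak_preimage)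
  then have "compactin euclidean (\<phi> ` (weak_topology closure_of A))"
    using assms image_compactin unfolding rel_weakly_compact_def by blast
  then have "bounded (\<phi> ` (weak_topology closure_of A))"
    by (simp add: compact_imp_bounded)
  then show "bounded (\<phi> ` A)"
    by (rule bounded_subset) (intro image_mono subset_weak_closure)
qed

text \<open>Clustering written out with basic weak neighbourhoods. Such points take the place of the
  limits that the Eberlein--Smulian theorem would supply.\<close>

definition weak_cluster_point :: "(nat \<Rightarrow> 'a::real_normed_vector) \<Rightarrow> 'a \<Rightarrow> bool" where
  "weak_cluster_point y z \<longleftrightarrow> (\<forall>(\<Phi> :: ('a \<Rightarrow>\<^sub>L real) set) e N. finite \<Phi> \<longrightarrow> e > 0 \<longrightarrow>
     (\<exists>n\<ge>N. \<forall>\<phi>\<in>\<Phi>. \<bar>blinfun_apply \<phi> (y n) - blinfun_apply \<phi> z\<bar> < e))"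

lemma weak_cluster_pointD:
  fixes \<Phi> :: "('a::real_normed_vector \<Rightarrow>\<^sub>L real) set"
  assumes "weak_cluster_point y z" "finite \<Phi>" "e > 0"
  shows "\<exists>n\<ge>N. \<forall>\<phi>\<in>\<Phi>. \<bar>blinfun_apply \<phi> (y n) - blinfun_apply \<phi> z\<bar> < e"
  using assms unfolding weak_cluster_point_def by blast

text \<open>Otherwise every \<open>z\<close> has a basic neighbourhood \<open>U z\<close> that the
  sequence avoids from index \<open>N z\<close> on. Finitely many of them cover the weak closure,
  and the sum of their \<open>N z\<close> is an index at which the sequence would have to avoid all
  of them.\<close>

lemma rel_weakly_compact_cluster_point:
  fixes A :: "'a::real_normed_vector set" and y :: "nat \<Rightarrow> 'a"
  assumes A: "rel_weakly_compact A" and y: "\<And>n. y n \<in> A"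
  shows "\<exists>z. weak_cluster_point y z"
proof (rule ccontr)
  assume none: "\<nexists>z. weak_cluster_point y z"
  have "\<exists>(\<Phi> :: ('a \<Rightarrow>\<^sub>L real) set) e N. finite \<Phi> \<and> e > 0 \<and> 
      (\<forall>n\<ge>N. \<exists>\<phi>\<in>\<Phi>. \<not> \<bar>blinfun_apply \<phi> (y n) - blinfun_apply \<phi> z\<bar> < e)" for z
    using none unfolding weak_cluster_point_def by meson
  then obtain \<Phi> :: "'a \<Rightarrow> ('a \<Rightarrow>\<^sub>L real) set" and e N where
    fin: "\<And>z. finite (\<Phi> z)" and e: "\<And>z. e z > 0"
    and far: "\<And>z n. n \<ge> N z \<Longrightarrow> \<exists>\<phi>\<in>\<Phi> z. \<not> \<bar>blinfun_apply \<phi> (y n) - blinfun_apply \<phi> z\<bar> < e z"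
    by metis
  define U where "U z = (\<Inter>\<phi>\<in>\<Phi> z. {x. blinfun_apply \<phi> x \<in> ball (blinfun_apply \<phi> z) (e z)})" for z
  have U: "openin weak_topology (U z)" for z
  proof (cases "\<Phi> z = {}")
    case True
    then show ?thesis using openin_topspace[of weak_topology] by (simp add: U_def)
  next
    case False
    then show ?thesis unfolding U_def using fin
      by (intro openin_INT2) (auto simp: openin_weak_preimage simp del: mem_ball)
  qed
  let ?K = "weak_topology closure_of A"
  have zU: "z \<in> U z" for z using e by (simp add: U_def)
  have "\<forall>V\<in>U ` ?K. openin weak_topology V" "?K \<subseteq> \<Union>(U ` ?K)" using U zU by auto
  then obtain F where F: "finite F" "F \<subseteq> U ` ?K" "?K \<subseteq> \<Union>F"
    using A unfolding rel_weakly_compact_def compactin_def by (elim conjE allE[of _ "U ` ?K"]) blast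
  obtain Z where "finite Z" "F = U ` Z" using finite_subset_image[OF F(1,2)] by blast
  then have Z: "finite Z" "?K \<subseteq> (\<Union>z\<in>Z. U z)" using F(3) by auto
  define M where "M = (\<Sum>z\<in>Z. N z)"
  have "y M \<in> ?K" using y subset_weak_closure by blast
  then obtain z where z: "z \<in> Z" "y M \<in> U z" using Z by blast
  have "N z \<le> M" unfolding M_def using z Z by (intro member_le_sum) auto
  then obtain \<phi> where "\<phi> \<in> \<Phi> z" "\<not> \<bar>\<phi> (y M) - \<phi> z\<bar> < e z" using far by blast
  then show False using z by (auto simp: U_def dist_real_def abs_minus_commute)
qed

section \<open>The Schur property and weak cluster points\<close>

lemma summable_of_sum_bound:
  fixes a :: "nat \<Rightarrow> real"
  assumes "\<And>N. (\<Sum>n<N. \<bar>a n\<bar>) \<le> B"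
  shows "summable (\<lambda>n. \<bar>a n\<bar>)"
  by (rule bounded_imp_summable[of _ B]) (use assms[of "Suc _"] in \<open>auto simp: lessThan_Suc_atMost\<close>)

text \<open>Along a sparse subsequence \<open>r\<close>, the functional \<open>\<Sum>j. k\<^bsub>r j\<^esub>\<close> separates the vectors \<open>y\<^bsub>r j\<^esub>\<close>
  from every weak cluster point.\<close>

lemma rel_weakly_compact_no_diagonal_hump:
  fixes k :: "nat \<Rightarrow> 'a::real_normed_vector \<Rightarrow>\<^sub>L real"
  assumes A: "rel_weakly_compact A" and y: "\<And>n. y n \<in> A"
    and sum: "\<And>N x. (\<Sum>n<N. \<bar>k n x\<bar>) \<le> C * norm x"
    and \<delta>: "\<delta> > 0" "\<And>n. k n (y n) \<ge> \<delta>"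
  shows False
proof -
  have sm: "summable (\<lambda>n. \<bar>k n x\<bar>)" for x by (rule summable_of_sum_bound[OF sum])
  have tails: "\<exists>N. \<forall>n\<ge>N. (\<Sum>p. \<bar>k (p + n) x\<bar>) < \<delta> / 8" for x
  proof -
    have "\<exists>N. \<forall>n\<ge>N. norm (\<Sum>p. \<bar>k (p + n) x\<bar>) < \<delta> / 8"
      using suminf_exist_split[OF _ sm, of "\<delta> / 8" x] \<delta> by simp
    then show ?thesis by (metis abs_ge_self le_less_trans real_norm_def)
  qed
  obtain z where z: "weak_cluster_point y z"
    using rel_weakly_compact_cluster_point[OF A, of y] y by blast
  \<comment> \<open>Choice of the index after \<open>m\<close>: the functionals up to
    \<open>m\<close> nearly agree on \<open>y n\<close> and on \<open>z\<close>, with an error so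
    small that \<open>m + 1\<close> of them add up to at most \<open>\<delta> / 8\<close>; the
    functionals from \<open>n\<close> on have total mass below \<open>\<delta> / 8\<close> at
    \<open>y m\<close>.\<close>
  have "\<exists>n>m. (\<forall>p\<le>m. \<bar>k p (y n) - k p z\<bar> < \<delta> / (8 * real (m + 1))) \<and> (\<Sum>p. \<bar>k (p + n) (y m)\<bar>) < \<delta> / 8" for m
  proof -
    obtain N where N: "\<forall>n\<ge>N. (\<Sum>p. \<bar>k (p + n) (y m)\<bar>) < \<delta> / 8" using tails by blast
    obtain n where "n \<ge> max N (Suc m)" "\<forall>\<phi>\<in>k ` {..m}. \<bar>blinfun_apply \<phi> (y n) - blinfun_apply \<phi> z\<bar> < \<delta> / (8 * real (m + 1))"
      using weak_cluster_pointD[OF z, of "k ` {..m}" "\<delta> / (8 * real (m + 1))" "max N (Suc m)"] \<delta> by auto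
    then show ?thesis using N by (intro exI[of _ n]) auto
  qed
  then obtain nx where nx: "\<And>m. nx m > m"
    "\<And>m p. p \<le> m \<Longrightarrow> \<bar>k p (y (nx m)) - k p z\<bar> < \<delta> / (8 * real (m + 1))"
    "\<And>m. (\<Sum>p. \<bar>k (p + nx m) (y m)\<bar>) < \<delta> / 8"
    by metis
  obtain n0 where n0: "\<forall>n\<ge>n0. (\<Sum>p. \<bar>k (p + n) z\<bar>) < \<delta> / 8" using tails by blast
  define r where "r j = (nx ^^ j) n0" for j
  have rSuc: "r (Suc j) = nx (r j)" for j by (simp add: r_def)
  have sr: "strict_mono r" by (rule strict_monoI_Suc) (simp add: rSuc nx)
  have r0: "n0 \<le> r j" for j
    using strict_mono_leD[OF sr, of 0 j] by (simp add: r_def)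
  have sub_tail: "summable (\<lambda>i. \<bar>k (r (i + j)) x\<bar>)" "(\<Sum>i. \<bar>k (r (i + j)) x\<bar>) \<le> (\<Sum>p. \<bar>k (p + r j) x\<bar>)" for j x
  proof -
    define g where "g i = r (i + j) - r j" for i
    have g: "r (i + j) = g i + r j" for i
      using strict_mono_leD[OF sr, of j "i + j"] by (simp add: g_def)
    have inj: "inj g"
      using strict_mono_imp_inj_on[OF sr] g by (metis add_right_cancel injD injI)
    have s: "summable (\<lambda>p. \<bar>k (p + r j) x\<bar>)" using summable_ignore_initial_segment[OF sm] .
    show "summable (\<lambda>i. \<bar>k (r (i + j)) x\<bar>)"
      using summable_reindex[OF s inj abs_ge_zero] by (simp add: o_def g)
    show "(\<Sum>i. \<bar>k (r (i + j)) x\<bar>) \<le> (\<Sum>p. \<bar>k (p + r j) x\<bar>)"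
      using suminf_reindex_mono[OF s inj abs_ge_zero] by (simp add: o_def g)
  qed
  have sk: "summable (\<lambda>i. k (r i) x)" for x
    using summable_rabs_cancel[OF sub_tail(1)[of 0 x, simplified]] .
  define \<psi> where "\<psi> = Blinfun (\<lambda>x. \<Sum>i. k (r i) x)"
  have bl: "bounded_linear (\<lambda>x. \<Sum>i. k (r i) x)"
  proof (rule bounded_linear_intro[of _ C])
    fix x x' :: 'a and c :: real
    show "(\<Sum>i. k (r i) (x + x')) = (\<Sum>i. k (r i) x) + (\<Sum>i. k (r i) x')"
      by (simp add: blinfun.add_right suminf_add[OF sk sk])
    show "(\<Sum>i. k (r i) (c *\<^sub>R x)) = c *\<^sub>R (\<Sum>i. k (r i) x)"
      by (simp add: blinfun.scaleR_right suminf_mult[OF sk])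
    have "norm (\<Sum>i. k (r i) x) \<le> (\<Sum>i. \<bar>k (r i) x\<bar>)"
      using summable_rabs[OF sub_tail(1)[of 0 x, simplified]] by simp
    also have "\<dots> \<le> (\<Sum>p. \<bar>k (p + r 0) x\<bar>)" using sub_tail(2)[of 0 x] by simp
    also have "\<dots> \<le> (\<Sum>p. \<bar>k p x\<bar>)"
      using suminf_split_initial_segment[OF sm, of x "r 0"] by (simp add: sum_nonneg)
    also have "\<dots> \<le> C * norm x" by (rule suminf_le_const[OF sm]) (rule sum)
    finally show "norm (\<Sum>i. k (r i) x) \<le> norm x * C" by (simp add: mult.commute)
  qed
  have \<psi>: "\<psi> x = (\<Sum>i. k (r i) x)" for x unfolding \<psi>_def bounded_linear_Blinfun_apply[OF bl] ..
  have head: "(\<Sum>i<j. \<bar>k (r i) (y (r j)) - k (r i) z\<bar>) \<le> \<delta> / 8" for j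
  proof (cases j)
    case (Suc l)
    have "(\<Sum>i<j. \<bar>k (r i) (y (r j)) - k (r i) z\<bar>) \<le> (\<Sum>i<j. \<delta> / (8 * real (r l + 1)))"
    proof (rule sum_mono)
      fix i assume "i \<in> {..<j}"
      then have "r i \<le> r l" using strict_mono_leD[OF sr, of i l] Suc by simp
      then show "\<bar>k (r i) (y (r j)) - k (r i) z\<bar> \<le> \<delta> / (8 * real (r l + 1))"
        unfolding Suc rSuc using nx(2) less_imp_le by blast
    qed
    also have "\<dots> = real (l + 1) * (\<delta> / (8 * real (r l + 1)))" by (simp add: Suc)
    also have "\<dots> \<le> real (r l + 1) * (\<delta> / (8 * real (r l + 1)))"
      using strict_mono_imp_increasing[OF sr, of l] \<delta> by (intro mult_right_mono) auto
    also have "\<dots> = \<delta> / 8" by (simp add: field_simps del: of_nat_add)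
    finally show ?thesis .
  qed (use \<delta> in simp)
  \<comment> \<open>The head error, the tail at \<open>y (r j)\<close> and the tail at
    \<open>z\<close> cost at most \<open>\<delta> / 8\<close> each, so the diagonal term, at least
    \<open>\<delta>\<close>, leaves more than \<open>\<delta> / 2\<close>.\<close>
  have hump: "\<psi> (y (r j)) \<ge> \<psi> z + \<delta> / 2" for j
  proof -
    have 1: "\<psi> (y (r j)) = (\<Sum>i<j. k (r i) (y (r j))) + k (r j) (y (r j)) + (\<Sum>i. k (r (i + Suc j)) (y (r j)))"
      unfolding \<psi> using suminf_split_initial_segment[OF sk, of "y (r j)" "Suc j"] by simp
    have 2: "\<psi> z = (\<Sum>i<j. k (r i) z) + (\<Sum>i. k (r (i + j)) z)"
      unfolding \<psi> using suminf_split_initial_segment[OF sk, of z j] by simp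
    have "\<bar>\<Sum>i. k (r (i + Suc j)) (y (r j))\<bar> \<le> (\<Sum>i. \<bar>k (r (i + Suc j)) (y (r j))\<bar>)"
      by (rule summable_rabs[OF sub_tail(1)])
    also have "\<dots> \<le> (\<Sum>p. \<bar>k (p + r (Suc j)) (y (r j))\<bar>)" by (rule sub_tail(2))
    also have "\<dots> < \<delta> / 8" unfolding rSuc by (rule nx(3))
    finally have 3: "\<bar>\<Sum>i. k (r (i + Suc j)) (y (r j))\<bar> < \<delta> / 8" .
    have "\<bar>\<Sum>i. k (r (i + j)) z\<bar> \<le> (\<Sum>i. \<bar>k (r (i + j)) z\<bar>)"
      by (rule summable_rabs[OF sub_tail(1)])
    also have "\<dots> \<le> (\<Sum>p. \<bar>k (p + r j) z\<bar>)" by (rule sub_tail(2))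
    also have "\<dots> < \<delta> / 8" using n0 r0 by blast
    finally have 4: "\<bar>\<Sum>i. k (r (i + j)) z\<bar> < \<delta> / 8" .
    have "\<bar>(\<Sum>i<j. k (r i) (y (r j))) - (\<Sum>i<j. k (r i) z)\<bar> \<le> \<delta> / 8"
      using order_trans[OF sum_abs head] by (simp add: sum_subtractf)
    then show ?thesis using 1 2 3 4 \<delta>(1) \<delta>(2)[of "r j"] unfolding abs_le_iff abs_less_iff by linarith
  qed
  \<comment> \<open>The point \<open>z\<close> need not be a cluster point of the subsequence, so a
    new one is taken. Along the subsequence each \<open>k (r i)\<close> converges to its value at
    \<open>z\<close>, hence \<open>z'\<close> has the same values and \<open>\<psi>\<close> cannot
    tell the two apart. The closeness of \<open>y (r (Suc l))\<close> to \<open>z\<close> is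
    controlled at stage \<open>r l\<close>, so the index used below has to be a successor.\<close>
  obtain z' where z': "weak_cluster_point (\<lambda>n. y (r n)) z'"
    using rel_weakly_compact_cluster_point[OF A, of "\<lambda>n. y (r n)"] y by blast
  have "k (r i) z' = k (r i) z" for i
  proof (rule ccontr)
    assume "k (r i) z' \<noteq> k (r i) z"
    define e where "e = \<bar>k (r i) z' - k (r i) z\<bar> / 2"
    have "e > 0" using \<open>k (r i) z' \<noteq> k (r i) z\<close> by (simp add: e_def)
    obtain M where M: "\<delta> / (8 * e) < real M" using reals_Archimedean2 by blast
    obtain n where n: "n \<ge> Suc (max i M)" "\<bar>k (r i) (y (r n)) - k (r i) z'\<bar> < e"
      using weak_cluster_pointD[OF z', of "{k (r i)}" e "Suc (max i M)"] \<open>e > 0\<close> by auto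
    obtain l where l: "n = Suc l" "i \<le> l" "M \<le> l" using n(1) by (cases n) auto
    have "\<bar>k (r i) (y (r n)) - k (r i) z\<bar> < \<delta> / (8 * real (r l + 1))"
      unfolding l rSuc using nx(2) strict_mono_leD[OF sr l(2)] by blast
    also have "\<dots> < e"
    proof -
      have "real M \<le> real (r l + 1)" using strict_mono_imp_increasing[OF sr, of l] l by simp
      then have "\<delta> / (8 * e) < real (r l + 1)" using M by linarith
      then show ?thesis using \<open>e > 0\<close> by (simp add: field_simps)
    qed
    finally have "\<bar>k (r i) z' - k (r i) z\<bar> < 2 * e" using n(2) by linarith
    then show False by (simp add: e_def)
  qed
  then have "\<psi> z' = \<psi> z" by (simp add: \<psi>)
  moreover obtain n where "\<bar>\<psi> (y (r n)) - \<psi> z'\<bar> < \<delta> / 2"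
    using weak_cluster_pointD[OF z', of "{\<psi>}" "\<delta> / 2" 0] \<delta> by auto
  ultimately show False using hump[of n] by linarith
qed

text \<open>The Schur property of \<open>\<ell>\<^sup>1\<close>, for the operator \<open>x \<mapsto> (k\<^sub>n x)\<^sub>n\<close> into \<open>\<ell>\<^sup>1\<close>.\<close>

lemma rel_weakly_compact_schur:
  fixes k :: "nat \<Rightarrow> 'a::real_normed_vector \<Rightarrow>\<^sub>L real"
  assumes A: "rel_weakly_compact A" and y: "\<And>n. y n \<in> A"
    and sum: "\<And>N x. (\<Sum>n<N. \<bar>k n x\<bar>) \<le> C * norm x"
  shows "(\<lambda>n. k n (y n)) \<longlonglongrightarrow> 0"
proof (rule ccontr)
  assume "\<not> (\<lambda>n. k n (y n)) \<longlonglongrightarrow> 0"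
  then obtain \<delta> where \<delta>: "\<delta> > 0" "\<And>N. \<exists>n\<ge>N. \<not> norm (k n (y n) - 0) < \<delta>"
    unfolding LIMSEQ_iff by blast
  then have "\<exists>\<^sub>\<infinity>n. \<bar>k n (y n)\<bar> \<ge> \<delta>" unfolding INFM_nat_le by (simp add: not_less)
  then have inf: "infinite {n. \<bar>k n (y n)\<bar> \<ge> \<delta>}" by (simp add: frequently_cofinite)
  define r where "r = enumerate {n. \<bar>k n (y n)\<bar> \<ge> \<delta>}"
  have sr: "strict_mono r" unfolding r_def by (rule strict_mono_enumerate[OF inf])
  have r: "\<bar>k (r n) (y (r n))\<bar> \<ge> \<delta>" for n using enumerate_in_set[OF inf, of n] by (simp add: r_def)
  show False
  \<comment> \<open>Multiplying by signs makes the diagonal values positive without increasing the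
    absolute sums, and a sum along \<open>r\<close> is part of a full sum up to
    \<open>r N\<close>.\<close>
  proof (rule rel_weakly_compact_no_diagonal_hump[OF A, of "\<lambda>n. y (r n)" "\<lambda>n. sgn (k (r n) (y (r n))) *\<^sub>R k (r n)" C \<delta>])
    fix N x
    have "(\<Sum>n<N. \<bar>(sgn (k (r n) (y (r n))) *\<^sub>R k (r n)) x\<bar>) \<le> (\<Sum>n<N. \<bar>k (r n) x\<bar>)"
      by (intro sum_mono) (simp add: blinfun.scaleR_left abs_mult abs_sgn_eq)
    also have "\<dots> = (\<Sum>m\<in>r ` {..<N}. \<bar>k m x\<bar>)"
      using strict_mono_imp_inj_on[OF sr] by (subst sum.reindex) (auto intro: inj_on_subset)
    also have "\<dots> \<le> (\<Sum>m<r N. \<bar>k m x\<bar>)"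
      by (rule sum_mono2) (auto simp: strict_mono_less[OF sr])
    also have "\<dots> \<le> C * norm x" by (rule sum)
    finally show "(\<Sum>n<N. \<bar>(sgn (k (r n) (y (r n))) *\<^sub>R k (r n)) x\<bar>) \<le> C * norm x" .
  next
    fix n
    have "sgn (k (r n) (y (r n))) * k (r n) (y (r n)) = \<bar>k (r n) (y (r n))\<bar>"
      by (simp add: abs_sgn mult.commute)
    then show "(sgn (k (r n) (y (r n))) *\<^sub>R k (r n)) (y (r n)) \<ge> \<delta>" using r by (simp add: blinfun.scaleR_left)
  qed (use y \<delta> in auto)
qed

subsection \<open>Disjoint sequences\<close>

text \<open>The functionals attached to \<open>|\<phi>|\<close> are pulled back along
  \<open>J\<close>, and the Schur property makes their diagonal values, which dominate
  \<open>|\<phi> (v n)|\<close>, tend to zero. The map \<open>J\<close> allows the weakly compact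
  set to live in another space than the lattice: it is the identity for \<open>E\<close> and
  \<open>Dual\<close> for functionals.\<close>

lemma disjoint_dominated_null:
  fixes J :: "'x::real_normed_vector \<Rightarrow> 'a::banach_lattice" and \<phi> :: "'a \<Rightarrow>\<^sub>L real"
  assumes J: "bounded_linear J" and A: "rel_weakly_compact A" "\<And>n. y n \<in> A"
    and v: "\<And>n. 0 \<le> v n" "disjoint_seq v" "\<And>n. v n \<le> labs (J (y n))"
  shows "(\<lambda>n. \<phi> (v n)) \<longlonglongrightarrow> 0"
proof -
  define \<psi> where "\<psi> = functional (labs (Dual \<phi>))"
  have \<phi>\<psi>: "\<bar>\<phi> u\<bar> \<le> \<psi> u" if "0 \<le> u" for u
    using functional_mono[OF labs_ge_self that, of "Dual \<phi>"] functional_mono[OF labs_ge_minus that, of "Dual \<phi>"]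
    by (simp add: \<psi>_def blinfun.minus_left)
  have pos: "0 \<le> \<psi> u" if "0 \<le> u" for u using \<phi>\<psi>[OF that] by simp
  obtain k where k: "\<And>n. \<psi> (v n) \<le> blinfun_apply (k n) (J (y n))"
    "\<And>N x. (\<Sum>n<N. \<bar>blinfun_apply (k n) x\<bar>) \<le> norm \<psi> * norm x"
    using disjoint_functionals[OF pos v] by blast
  obtain K where K: "\<And>x. norm (J x) \<le> norm x * K" using bounded_linear.bounded[OF J] by blast
  define k' where "k' n = k n o\<^sub>L Blinfun J" for n
  have k': "k' n x = k n (J x)" for n x by (simp add: k'_def bounded_linear_Blinfun_apply[OF J])
  have "(\<lambda>n. k' n (y n)) \<longlonglongrightarrow> 0"
  proof (rule rel_weakly_compact_schur[OF A, of _ "norm \<psi> * K"])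
    fix N x
    have "(\<Sum>n<N. \<bar>k' n x\<bar>) \<le> norm \<psi> * norm (J x)" unfolding k' by (rule k(2))
    also have "\<dots> \<le> norm \<psi> * (norm x * K)" by (intro mult_left_mono K) simp
    finally show "(\<Sum>n<N. \<bar>k' n x\<bar>) \<le> norm \<psi> * K * norm x" by (simp add: mult_ac)
  qed
  then have "(\<lambda>n. k n (J (y n))) \<longlonglongrightarrow> 0" by (simp add: k')
  then show ?thesis
    by (rule Lim_null_comparison[rotated])
      (use order_trans[OF \<phi>\<psi>[OF v(1)] k(1)] in \<open>auto intro: always_eventually\<close>)
qed

text \<open>\<open>z - x / a\<close> is \<open>1 / a\<close> times the negative of
  \<open>x - a z\<close>; as \<open>a \<ge> 1\<close>, its positive part lies below the negative
  part of \<open>x - a z\<close>.\<close>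

lemma ppart_disjoint:
  fixes x z :: "'a::banach_lattice"
  assumes "1 \<le> a"
  shows "inf (ppart (x - a *\<^sub>R z)) (ppart (z - (1 / a) *\<^sub>R x)) = 0"
proof (rule inf_zero_mono[OF _ _ order_refl _ inf_ppart_npart])
  have "z - (1 / a) *\<^sub>R x = (1 / a) *\<^sub>R (a *\<^sub>R z - x)" using assms by (simp add: algebra_simps)
  also have "\<dots> \<le> (1 / a) *\<^sub>R npart (x - a *\<^sub>R z)"
    using assms by (intro scaleR_left_mono) (auto simp: npart_def)
  also have "\<dots> \<le> 1 *\<^sub>R npart (x - a *\<^sub>R z)" using assms by (intro scaleR_right_mono) auto
  finally show "ppart (z - (1 / a) *\<^sub>R x) \<le> npart (x - a *\<^sub>R z)" by (simp add: ppart_def)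
qed auto

text \<open>The positive parts themselves need not be disjoint; subtracting the further small
  element \<open>(1/2) ^ n y\<close>, with \<open>y\<close> the sum of all
  \<open>(1/2) ^ i p i\<close>, makes them so. For \<open>n < m\<close> the multiple of
  \<open>S m\<close> puts \<open>v m\<close> below \<open>(p m - 4 ^ m p n)^+\<close>, and the
  multiple of \<open>y\<close> puts \<open>v n\<close> below \<open>(p n - p m / 4 ^ m)^+\<close>.
  The correction has norm at most \<open>(1/2) ^ n * norm y\<close>.\<close>

lemma disjoint_approximation:
  fixes p :: "nat \<Rightarrow> 'a::banach_lattice"
  assumes p: "\<And>n. 0 \<le> p n" "\<And>n. norm (p n) \<le> M"
  obtains v where "disjoint_seq v" "\<And>n. 0 \<le> v n" "\<And>n. v n \<le> p n"
    "(\<lambda>n. ppart (p n - 4 ^ n *\<^sub>R (\<Sum>i<n. p i)) - v n) \<longlonglongrightarrow> 0"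
proof -
  define S where "S n = (\<Sum>i<n. p i)" for n
  have S0: "0 \<le> S n" for n unfolding S_def by (intro sum_nonneg p)
  have sm: "summable (\<lambda>i. (1/2) ^ i *\<^sub>R p i)"
    by (rule summable_comparison_test'[of "\<lambda>n. (1/2) ^ n * M"])
      (use p in \<open>auto intro!: summable_mult2 mult_left_mono\<close>)
  define y where "y = (\<Sum>i. (1/2) ^ i *\<^sub>R p i)"
  have y: "(1/2) ^ i *\<^sub>R p i \<le> y" for i
    unfolding y_def by (rule term_le_suminf[OF sm]) (simp add: p scaleR_nonneg_nonneg)
  have y0: "0 \<le> y" using order_trans[OF _ y[of 0]] p by simp
  define v where "v n = ppart (p n - 4 ^ n *\<^sub>R S n - (1/2) ^ n *\<^sub>R y)" for n
  have v0: "0 \<le> v n" for n by (simp add: v_def)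
  have disj: "inf (v m) (v n) = 0" if "n < m" for m n
  proof (rule inf_zero_mono[OF v0 v0 _ _ ppart_disjoint[of "4 ^ m" "p m" "p n"]])
    have "p n \<le> S m"
      unfolding S_def using sum_mono2[of "{..<m}" "{n}" p] that p by auto
    then have "4 ^ m *\<^sub>R p n \<le> 4 ^ m *\<^sub>R S m" by (intro scaleR_left_mono) auto
    also have "\<dots> \<le> 4 ^ m *\<^sub>R S m + (1/2) ^ m *\<^sub>R y" using y0 by (simp add: scaleR_nonneg_nonneg)
    finally show "v m \<le> ppart (p m - 4 ^ m *\<^sub>R p n)"
      unfolding v_def unfolding diff_diff_eq by (intro ppart_mono diff_left_mono)
    \<comment> \<open>The reason for base 4: one factor \<open>(1/2) ^ m\<close> brings
      \<open>p m\<close> below \<open>y\<close>, the other is at most the \<open>(1/2) ^ n\<close>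
      available in \<open>v n\<close>.\<close>
    have "(1 / 4 ^ m :: real) = (1/2) ^ m * (1/2) ^ m" by (simp add: power_divide flip: power_mult_distrib)
    also have "\<dots> \<le> (1/2) ^ n * (1/2) ^ m"
      using that by (intro mult_right_mono power_decreasing) auto
    finally have "(1 / 4 ^ m) *\<^sub>R p m \<le> ((1/2) ^ n * (1/2) ^ m) *\<^sub>R p m"
      by (intro scaleR_right_mono p)
    also have "\<dots> \<le> (1/2) ^ n *\<^sub>R y"
      using scaleR_left_mono[OF y[of m], of "(1/2) ^ n"] by simp
    also have "\<dots> \<le> 4 ^ n *\<^sub>R S n + (1/2) ^ n *\<^sub>R y" using S0 by (simp add: scaleR_nonneg_nonneg)
    finally show "v n \<le> ppart (p n - (1 / 4 ^ m) *\<^sub>R p m)"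
      unfolding v_def unfolding diff_diff_eq by (intro ppart_mono diff_left_mono)
  qed simp
  have near: "norm (ppart (p n - 4 ^ n *\<^sub>R S n) - v n) \<le> (1/2) ^ n * norm y" for n
  proof -
    define w where "w = p n - 4 ^ n *\<^sub>R S n"
    have b: "0 \<le> (1/2) ^ n *\<^sub>R y" using y0 by (simp add: scaleR_nonneg_nonneg)
    have "w - (1/2) ^ n *\<^sub>R y \<le> v n" unfolding v_def w_def by (rule le_ppart)
    then have "w \<le> v n + (1/2) ^ n *\<^sub>R y" by (simp add: diff_le_eq)
    moreover have "0 \<le> v n + (1/2) ^ n *\<^sub>R y" using v0 b by simp
    ultimately have "ppart w - v n \<le> (1/2) ^ n *\<^sub>R y" by (simp add: ppart_def diff_le_eq add.commute)
    moreover have "v n \<le> ppart w" unfolding v_def w_def using b by (intro ppart_mono) (simp add: w_def)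
    ultimately have "norm (ppart w - v n) \<le> norm ((1/2) ^ n *\<^sub>R y)" by (intro norm_mono_nonneg) auto
    then show ?thesis by (simp add: w_def)
  qed
  show thesis
  proof
    show "disjoint_seq v"
      unfolding disjoint_seq_def
    proof (intro allI impI)
      fix n m :: nat assume "n \<noteq> m"
      then show "inf (labs (v n)) (labs (v m)) = 0"
        using disj[of n m] disj[of m n] v0 by (cases n m rule: linorder_cases) (auto simp: inf.commute)
    qed
    show "0 \<le> v n" for n by (rule v0)
    have "4 ^ n *\<^sub>R S n + (1/2) ^ n *\<^sub>R y \<ge> 0" for n using S0 y0 by (simp add: scaleR_nonneg_nonneg)
    then have "p n - 4 ^ n *\<^sub>R S n - (1/2) ^ n *\<^sub>R y \<le> p n" for n
      unfolding diff_diff_eq by (simp only: diff_le_eq le_add_same_cancel1)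
    then show "v n \<le> p n" for n unfolding v_def using ppart_mono p by (metis ppart_of_nonneg)
    have "(\<lambda>n. (1/2) ^ n * norm y) \<longlonglongrightarrow> 0"
      by (intro tendsto_mult_left_zero LIMSEQ_power_zero) simp
    then show "(\<lambda>n. ppart (p n - 4 ^ n *\<^sub>R (\<Sum>i<n. p i)) - v n) \<longlonglongrightarrow> 0"
      by (rule Lim_null_comparison[rotated]) (use near in \<open>auto simp: S_def intro: always_eventually\<close>)
  qed
qed

section \<open>Disjointification in both arguments of a bilinear form\<close>

lemma bounded_bilinear_null_left:
  assumes b: "bounded_bilinear b" and d: "d \<longlonglongrightarrow> 0" and q: "\<And>n. norm (q n) \<le> M"
  shows "(\<lambda>n. b (d n) (q n)) \<longlonglongrightarrow> 0"
proof -
  obtain K where K: "0 \<le> K" "\<And>x y. norm (b x y) \<le> norm x * norm y * K"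
    using bounded_bilinear.nonneg_bounded[OF b] by blast
  have "norm (b (d n) (q n)) \<le> norm (d n) * (M * K)" for n
    using K(2)[of "d n" "q n"] mult_left_mono[OF mult_right_mono[OF q[of n] K(1)] norm_ge_zero[of "d n"]]
    by (simp add: mult.assoc)
  moreover have "(\<lambda>n. norm (d n) * (M * K)) \<longlonglongrightarrow> 0"
    using d by (intro tendsto_mult_left_zero tendsto_norm_zero)
  ultimately show ?thesis by (intro Lim_null_comparison[of "\<lambda>n. b (d n) (q n)"] always_eventually allI)
qed

text \<open>Stated for an abstract form so that it can be applied again with the arguments
  exchanged. \<open>dp\<close> covers sequences disjoint on both sides; \<open>null\<close> controls
  what the second disjointification discards, uniformly over \<open>[0, h]\<close> because the
  discarded parts \<open>inf (q n) h\<close> vary.\<close>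

lemma bilinear_disjoint_bound:
  fixes b :: "'a::banach_lattice \<Rightarrow> 'c::banach_lattice \<Rightarrow> real"
  assumes b: "bounded_bilinear b"
    and P: "bounded P" "\<And>p. p \<in> P \<Longrightarrow> 0 \<le> p" and Q: "bounded Q" "\<And>q. q \<in> Q \<Longrightarrow> 0 \<le> q"
    and null: "\<And>p v h e. (\<And>n. p n \<in> P) \<Longrightarrow> (\<And>n. 0 \<le> v n) \<Longrightarrow> (\<And>n. v n \<le> p n) \<Longrightarrow>
      disjoint_seq v \<Longrightarrow> 0 \<le> h \<Longrightarrow> 0 < e \<Longrightarrow> \<exists>N::nat. \<forall>n\<ge>N. \<forall>k\<in>{0..h}. \<bar>b (v n) k\<bar> \<le> e"
    and dp: "\<And>p v q g. (\<And>n. p n \<in> P) \<Longrightarrow> (\<And>n. 0 \<le> v n) \<Longrightarrow> (\<And>n. v n \<le> p n) \<Longrightarrow>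
      disjoint_seq v \<Longrightarrow> (\<And>n. q n \<in> Q) \<Longrightarrow> (\<And>n. 0 \<le> g n) \<Longrightarrow> (\<And>n. g n \<le> q n) \<Longrightarrow>
      disjoint_seq g \<Longrightarrow> (\<lambda>n. b (v n) (g n)) \<longlonglongrightarrow> 0"
    and \<epsilon>: "0 < \<epsilon>"
  shows "\<exists>u\<ge>0. \<forall>p\<in>P. \<forall>q\<in>Q. b (ppart (p - u)) q \<le> \<epsilon>"
proof (rule ccontr)
  assume "\<not> ?thesis"
  then have "\<forall>u. \<exists>p q. 0 \<le> u \<longrightarrow> p \<in> P \<and> q \<in> Q \<and> b (ppart (p - u)) q > \<epsilon>" by (meson not_le)
  then obtain X Y where XY: "\<And>u. 0 \<le> u \<Longrightarrow> X u \<in> P" "\<And>u. 0 \<le> u \<Longrightarrow> Y u \<in> Q"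
    "\<And>u. 0 \<le> u \<Longrightarrow> b (ppart (X u - u)) (Y u) > \<epsilon>" by metis
  obtain MP MQ where MP: "\<And>p. p \<in> P \<Longrightarrow> norm p \<le> MP" and MQ: "\<And>q. q \<in> Q \<Longrightarrow> norm q \<le> MQ"
    using P(1) Q(1) by (auto simp: bounded_iff)
  interpret b: bounded_bilinear b by (rule b)
  \<comment> \<open>The assumed failure is used at \<open>u = 4 ^ n S n\<close>, where
    \<open>S n\<close> sums the elements chosen earlier; this is exactly the threshold subtracted in
    \<open>disjoint_approximation\<close>.\<close>
  define S where "S = rec_nat 0 (\<lambda>n s. s + X (4 ^ n *\<^sub>R s))"
  define p where "p n = X (4 ^ n *\<^sub>R S n)" for n
  define q where "q n = Y (4 ^ n *\<^sub>R S n)" for n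
  have Ssum: "S n = (\<Sum>i<n. p i)" for n by (induction n) (simp_all add: S_def p_def)
  have S0: "0 \<le> S n" for n
  proof (induction n)
    case (Suc n)
    then have "0 \<le> X (4 ^ n *\<^sub>R S n)" by (intro P(2)[OF XY(1)] scaleR_nonneg_nonneg) auto
    then show ?case using Suc by (simp add: S_def)
  qed (simp add: S_def)
  have S0': "0 \<le> 4 ^ n *\<^sub>R S n" for n using S0 by (simp add: scaleR_nonneg_nonneg)
  have pP: "p n \<in> P" and qQ: "q n \<in> Q" for n unfolding p_def q_def by (auto intro: XY S0')
  have p: "0 \<le> p n" "norm (p n) \<le> MP" and q: "0 \<le> q n" "norm (q n) \<le> MQ" for n
    using P(2)[OF pP] MP[OF pP] Q(2)[OF qQ] MQ[OF qQ] by auto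
  obtain v where v: "disjoint_seq v" "\<And>n. 0 \<le> v n" "\<And>n. v n \<le> p n"
    "(\<lambda>n. ppart (p n - 4 ^ n *\<^sub>R (\<Sum>i<n. p i)) - v n) \<longlonglongrightarrow> 0"
    by (rule disjoint_approximation[of p MP]) (use p in auto)
  have vM: "norm (v n) \<le> MP" for n using order_trans[OF norm_mono_nonneg[OF v(2,3)] p(2)] .
  have "(\<lambda>n. b (ppart (p n - 4 ^ n *\<^sub>R (\<Sum>i<n. p i)) - v n) (q n)) \<longlonglongrightarrow> 0"
    by (rule bounded_bilinear_null_left[OF b v(4)]) (rule q(2))
  then have "\<forall>\<^sub>F n in sequentially. b (ppart (p n - 4 ^ n *\<^sub>R S n) - v n) (q n) < \<epsilon> / 2"
    unfolding Ssum by (rule order_tendstoD) (use \<epsilon> in simp)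
  then obtain N0 where N0: "\<And>n. n \<ge> N0 \<Longrightarrow> b (ppart (p n - 4 ^ n *\<^sub>R S n) - v n) (q n) < \<epsilon> / 2"
    by (auto simp: eventually_sequentially)
  have big: "b (v n) (q n) > \<epsilon> / 2" if "n \<ge> N0" for n
    using N0[OF that] XY(3)[OF S0'[of n]] by (simp add: b.diff_left p_def q_def)
  \<comment> \<open>Claimed for every \<open>h\<close> so that the choice function \<open>R\<close>
    is total; if \<open>h\<close> is not positive, the interval is empty.\<close>
  have ex: "\<exists>n. n > m \<and> (\<forall>k\<in>{0..h}. \<bar>b (v n) k\<bar> \<le> \<epsilon> / 8)" for h m
  proof (cases "0 \<le> h")
    case True
    then obtain N where N: "\<forall>n\<ge>N. \<forall>k\<in>{0..h}. \<bar>b (v n) k\<bar> \<le> \<epsilon> / 8"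
      using null[of p v h "\<epsilon> / 8"] pP v \<epsilon> by auto
    then show ?thesis by (intro exI[of _ "max N (Suc m)"]) auto
  qed (use order_trans in fastforce)
  define R where "R h m = (SOME n. n > m \<and> (\<forall>k\<in>{0..h}. \<bar>b (v n) k\<bar> \<le> \<epsilon> / 8))" for h m
  have R: "R h m > m" "\<forall>k\<in>{0..h}. \<bar>b (v (R h m)) k\<bar> \<le> \<epsilon> / 8" for h m
    using someI_ex[OF ex[of m h]] unfolding R_def by auto
  \<comment> \<open>The state is the sum of the \<open>q\<close> chosen so far and the last index.
    The threshold \<open>4 ^ j\<close> times that sum is fixed before \<open>r j\<close> is
    selected, so \<open>R\<close> can make \<open>v (r j)\<close> small on the whole interval below
    it. Starting from \<open>N0\<close> keeps all indices in the range of
    \<open>big\<close>.\<close>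
  define G where "G = rec_nat (0, N0) (\<lambda>j (g, m). (g + q (R (4 ^ j *\<^sub>R g) m), R (4 ^ j *\<^sub>R g) m))"
  define r where "r j = snd (G (Suc j))" for j
  have G: "fst (G (Suc j)) = fst (G j) + q (r j)" "r j = R (4 ^ j *\<^sub>R fst (G j)) (snd (G j))" for j
    by (simp_all add: r_def G_def split_beta)
  have Gsum: "fst (G j) = (\<Sum>i<j. q (r i))" for j by (induction j) (simp_all add: G, simp add: G_def)
  have r: "r j = R (4 ^ j *\<^sub>R (\<Sum>i<j. q (r i))) (snd (G j))" for j using G(2)[of j] Gsum[of j] by simp
  have G0: "0 \<le> 4 ^ j *\<^sub>R (\<Sum>i<j. q (r i))" for j
    using q by (intro scaleR_nonneg_nonneg sum_nonneg) auto
  have rsuc: "r (Suc j) > r j" for j using R(1) r[of "Suc j"] by (metis r_def)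
  have "snd (G 0) = N0" by (simp add: G_def)
  then have r0: "r 0 > N0" using R(1) r[of 0] by metis
  have sr: "strict_mono r" by (rule strict_monoI_Suc) (rule rsuc)
  have rN: "r j \<ge> N0" for j using strict_mono_leD[OF sr, of 0 j] r0 by simp
  obtain g where g: "disjoint_seq g" "\<And>n. 0 \<le> g n" "\<And>n. g n \<le> q (r n)"
    "(\<lambda>n. ppart (q (r n) - 4 ^ n *\<^sub>R (\<Sum>i<n. q (r i))) - g n) \<longlonglongrightarrow> 0"
    by (rule disjoint_approximation[of "\<lambda>n. q (r n)" MQ]) (use q in auto)
  have "(\<lambda>n. b (v (r n)) (g n)) \<longlonglongrightarrow> 0"
  proof (rule dp[of "\<lambda>n. p (r n)" _ "\<lambda>n. q (r n)"])
    show "disjoint_seq (\<lambda>n. v (r n))"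
      using v(1) strict_mono_eq[OF sr] by (simp add: disjoint_seq_def)
  qed (use pP qQ v g in auto)
  moreover have "(\<lambda>n. b (v (r n)) (ppart (q (r n) - 4 ^ n *\<^sub>R (\<Sum>i<n. q (r i))) - g n)) \<longlonglongrightarrow> 0"
    using bounded_bilinear_null_left[OF b.flip g(4), of "\<lambda>n. v (r n)" MP] vM by simp
  ultimately have "(\<lambda>n. b (v (r n)) (g n) + b (v (r n)) (ppart (q (r n) - 4 ^ n *\<^sub>R (\<Sum>i<n. q (r i))) - g n)) \<longlonglongrightarrow> 0"
    by (rule tendsto_add_zero)
  then have "(\<lambda>n. b (v (r n)) (ppart (q (r n) - 4 ^ n *\<^sub>R (\<Sum>i<n. q (r i))))) \<longlonglongrightarrow> 0"
    by (simp add: b.diff_right)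
  then have "\<forall>\<^sub>F n in sequentially. b (v (r n)) (ppart (q (r n) - 4 ^ n *\<^sub>R (\<Sum>i<n. q (r i)))) < \<epsilon> / 4"
    by (rule order_tendstoD) (use \<epsilon> in simp)
  then obtain n where n: "b (v (r n)) (ppart (q (r n) - 4 ^ n *\<^sub>R (\<Sum>i<n. q (r i)))) < \<epsilon> / 4"
    by (auto simp: eventually_sequentially)
  \<comment> \<open>The value above \<open>\<epsilon> / 2\<close> at \<open>q (r n)\<close> splits
    along \<open>h\<close> into a part of at most \<open>\<epsilon> / 8\<close> and a part below
    \<open>\<epsilon> / 4\<close>.\<close>
  define h where "h = 4 ^ n *\<^sub>R (\<Sum>i<n. q (r i))"
  have "\<bar>b (v (r n)) (inf (q (r n)) h)\<bar> \<le> \<epsilon> / 8"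
  proof -
    have "inf (q (r n)) h \<in> {0..h}" using G0[of n] q by (auto simp: h_def)
    then show ?thesis using R(2)[of h] unfolding r[of n] h_def by blast
  qed
  moreover have "q (r n) = inf (q (r n)) h + ppart (q (r n) - h)"
    by (simp only: diff_inf_eq_ppart[symmetric]) (metis add.commute diff_add_cancel)
  then have "b (v (r n)) (q (r n)) = b (v (r n)) (inf (q (r n)) h) + b (v (r n)) (ppart (q (r n) - h))"
    by (metis b.add_right)
  ultimately show False using n big[OF rN[of n]] \<epsilon> by (simp add: h_def)
qed

subsection \<open>Order bounded operators\<close>

text \<open>The functional is \<open>h \<circ> |T|\<close>, where the modulus \<open>|T|\<close> exists only as an operator into the
  bidual; its value at \<open>x\<close> is obtained from finite suprema in \<open>T[-x, x]\<close>.\<close>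

lemma modulus_functional:
  fixes T :: "'a::banach_lattice \<Rightarrow> 'b::banach_lattice" and h :: "'b \<Rightarrow>\<^sub>L real"
  assumes T: "linear T" "order_bounded_op T" and h: "\<And>y. 0 \<le> y \<Longrightarrow> 0 \<le> h y"
  shows "\<exists>\<phi>::'a \<Rightarrow>\<^sub>L real. \<forall>x\<ge>0. h (labs (T x)) \<le> blinfun_apply \<phi> x"
proof -
  define FS where "FS x = {U. finite U \<and> U \<noteq> {} \<and> U \<subseteq> {- x..x}}" for x :: 'a
  define H where "H U = h (Sup_fin (T ` U))" for U
  define m where "m x = (SUP U\<in>FS x. H U)" for x
  have bdd: "bdd_above (H ` FS x)" for x
  proof -
    obtain a b where ab: "T ` {- x..x} \<subseteq> {a..b}" using order_bounded_op_interval[OF T(2)] by blast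
    show ?thesis
    proof (rule bdd_aboveI2)
      fix U assume U: "U \<in> FS x"
      have "Sup_fin (T ` U) \<le> b"
        using U ab by (intro Sup_fin.boundedI) (fastforce simp: FS_def)+
      then show "H U \<le> h b" unfolding H_def by (rule blinfun_mono[OF h, rotated])
    qed
  qed
  have FS0: "{0} \<in> FS x" if "0 \<le> x" for x using that by (simp add: FS_def)
  have add: "m (x + y) = m x + m y" if xy: "0 \<le> x" "0 \<le> y" for x y
  proof (rule antisym)
    show "m (x + y) \<le> m x + m y"
      unfolding m_def[of "x + y"]
    proof (rule cSUP_least)
      show "FS (x + y) \<noteq> {}" using FS0[of "x + y"] xy by auto
      fix U assume U: "U \<in> FS (x + y)"
      have "\<exists>c d. u = c + d \<and> c \<in> {- x..x} \<and> d \<in> {- y..y}" if "u \<in> U" for u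
      proof -
        have u: "- (x + y) \<le> u" "u \<le> x + y" using U that by (auto simp: FS_def)
        \<comment> \<open>Riesz decomposition concerns positive elements, so the symmetric interval
          is first translated by \<open>x + y\<close>.\<close>
        have "0 \<le> u + (x + y)" using add_right_mono[OF u(1), of "x + y"] by simp
        moreover have "u + (x + y) \<le> (x + x) + (y + y)" using add_right_mono[OF u(2), of "x + y"] by (simp add: ac_simps)
        ultimately obtain c d where cd: "u + (x + y) = c + d" "0 \<le> c" "c \<le> x + x" "0 \<le> d" "d \<le> y + y"
          using riesz_decomposition[of "x + x" "y + y" "u + (x + y)"] xy by auto
        have "u = (c - x) + (d - y)" using cd(1) by (simp add: algebra_simps)
        moreover have "c - x \<in> {- x..x}" "d - y \<in> {- y..y}" using cd(2-5) by (auto simp: diff_le_eq)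
        ultimately show ?thesis by blast
      qed
      then obtain c d where cd: "\<And>u. u \<in> U \<Longrightarrow> u = c u + d u" "\<And>u. u \<in> U \<Longrightarrow> c u \<in> {- x..x}"
        "\<And>u. u \<in> U \<Longrightarrow> d u \<in> {- y..y}" by metis
      have fin: "finite U" "U \<noteq> {}" using U by (auto simp: FS_def)
      have cU: "c ` U \<in> FS x" and dU: "d ` U \<in> FS y" using fin cd(2,3) by (auto simp: FS_def)
      have "Sup_fin (T ` U) \<le> Sup_fin (T ` c ` U) + Sup_fin (T ` d ` U)"
      proof (rule Sup_fin.boundedI)
        fix t assume "t \<in> T ` U"
        then obtain u where u: "u \<in> U" "t = T u" by auto
        have "T u = T (c u) + T (d u)" using linear_add[OF T(1)] cd(1)[OF u(1)] by metis
        also have "\<dots> \<le> Sup_fin (T ` c ` U) + Sup_fin (T ` d ` U)"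
          using fin u by (intro add_mono Sup_fin.coboundedI) auto
        finally show "t \<le> Sup_fin (T ` c ` U) + Sup_fin (T ` d ` U)" using u by simp
      qed (use fin in auto)
      from blinfun_mono[OF h this] have "H U \<le> H (c ` U) + H (d ` U)"
        by (simp add: H_def blinfun.add_right)
      also have "\<dots> \<le> m x + m y"
        unfolding m_def using cU dU by (intro add_mono cSUP_upper bdd)
      finally show "H U \<le> m x + m y" .
    qed
    have "H U + H V \<le> m (x + y)" if UV: "U \<in> FS x" "V \<in> FS y" for U V
    proof -
      \<comment> \<open>\<open>W\<close> is the set of sums \<open>U + V\<close>; as
        \<open>T\<close> is additive, the supremum over its image dominates the sum of the two
        suprema.\<close>
      define W where "W = (\<lambda>(u, v). u + v) ` (U \<times> V)"
      have fin: "finite U" "U \<noteq> {}" "finite V" "V \<noteq> {}" using UV by (auto simp: FS_def)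
      have finW: "finite W" "W \<noteq> {}" using fin by (auto simp: W_def)
      have "W \<subseteq> {- (x + y)..x + y}"
      proof
        fix w assume "w \<in> W"
        then obtain u v where "w = u + v" "u \<in> U" "v \<in> V" by (auto simp: W_def)
        then have uv: "w = u + v" "u \<in> {- x..x}" "v \<in> {- y..y}" using UV by (auto simp: FS_def)
        have "- x + - y \<le> u + v" using uv by (intro add_mono) auto
        then show "w \<in> {- (x + y)..x + y}" using uv by (auto intro: add_mono)
      qed
      then have W: "W \<in> FS (x + y)" using finW by (simp add: FS_def)
      have "T u \<le> Sup_fin (T ` W) - Sup_fin (T ` V)" if u: "u \<in> U" for u
      proof -
        have "Sup_fin (T ` V) \<le> Sup_fin (T ` W) - T u"
        proof (rule Sup_fin.boundedI)
          fix t assume "t \<in> T ` V"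
          then obtain v where v: "v \<in> V" "t = T v" by auto
          have "u + v \<in> W" using u v by (auto simp: W_def)
          then have "T (u + v) \<le> Sup_fin (T ` W)" using finW by (intro Sup_fin.coboundedI) auto
          then show "t \<le> Sup_fin (T ` W) - T u"
            using v by (simp add: linear_add[OF T(1)] le_diff_eq add.commute)
        qed (use fin in auto)
        then show ?thesis by (simp add: le_diff_eq add.commute)
      qed
      then have "Sup_fin (T ` U) \<le> Sup_fin (T ` W) - Sup_fin (T ` V)"
        using fin by (intro Sup_fin.boundedI) auto
      from blinfun_mono[OF h this] have "H U + H V \<le> H W" by (simp add: H_def blinfun.diff_right)
      also have "\<dots> \<le> m (x + y)" unfolding m_def by (rule cSUP_upper[OF W bdd])
      finally show ?thesis .
    qed
    then have "m y \<le> m (x + y) - H U" if "U \<in> FS x" for U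
      unfolding m_def[of y] using that FS0[OF xy(2)]
      by (intro cSUP_least) (auto simp: le_diff_eq add.commute[of _ "H U"])
    then have "m x \<le> m (x + y) - m y"
      unfolding m_def[of x] using FS0[OF xy(1)]
      by (intro cSUP_least) (auto simp: le_diff_eq add.commute[of _ "m y"])
    then show "m x + m y \<le> m (x + y)" by simp
  qed
  have nonneg: "0 \<le> m x" if "0 \<le> x" for x
  proof -
    have "H {0} = 0" by (simp add: H_def linear_0[OF T(1)])
    then show ?thesis using cSUP_upper[OF FS0[OF that] bdd] by (simp add: m_def)
  qed
  have dom: "h (labs (T x)) \<le> m x" if "0 \<le> x" for x
  proof -
    have "{x, - x} \<in> FS x" using that minus_le_self_iff[of x] by (auto simp: FS_def)
    moreover have "H {x, - x} = h (labs (T x))"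
      by (simp add: H_def labs_def linear_neg[OF T(1)])
    ultimately show ?thesis unfolding m_def using cSUP_upper[OF _ bdd] by metis
  qed
  then show ?thesis
    using cone_extension_apply[OF add nonneg] by (intro exI[of _ "cone_extension m"]) auto
qed

section \<open>The bilinear estimate applied to the pairing of \<open>T x\<close> with
  functionals\<close>

lemma abs_functional_le:
  assumes "0 \<le> k" "k \<le> h"
  shows "\<bar>functional k y\<bar> \<le> functional h (labs y)"
proof -
  have "0 \<le> functional k u" if "0 \<le> u" for u using functional_mono[OF assms(1) that] by simp
  then have "\<bar>functional k y\<bar> \<le> functional k (labs y)" by (rule abs_blinfun_le_labs)
  also have "\<dots> \<le> functional h (labs y)" by (rule functional_mono[OF assms(2)]) simp
  finally show ?thesis .
qed

theorem theorem2p5: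
  fixes T :: "'a::banach_lattice \<Rightarrow> 'b::banach_lattice"
  assumes "linear T"
    and "order_bounded_op T"
    and "almost_weak_DP T"
  shows "(\<forall>(A :: 'a set) (B :: ('b \<Rightarrow>\<^sub>L real) set) (\<epsilon>::real).
            rel_weakly_compact A \<and> rel_weakly_compact B \<and> \<epsilon> > 0 \<longrightarrow>
            (\<exists>u. 0 \<le> u \<and> (\<forall>x\<in>A. \<forall>f\<in>B.
               dual_abs (blinfun_apply f) (T (ppart (labs x - u))) \<le> \<epsilon>)))
       \<and> (\<forall>(A :: 'a set) (B :: ('b \<Rightarrow>\<^sub>L real) set) (\<epsilon>::real).
            rel_weakly_compact A \<and> rel_weakly_compact B \<and> \<epsilon> > 0 \<longrightarrow>
            (\<exists>g :: 'b \<Rightarrow>\<^sub>L real. dual_nonneg (blinfun_apply g) \<and> (\<forall>x\<in>A. \<forall>f\<in>B.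
               dual_ppart (\<lambda>y. dual_abs (blinfun_apply f) y - g y) (T (labs x)) \<le> \<epsilon>)))"
proof -
  have T: "bounded_linear T" by (rule order_bounded_imp_bounded_linear[OF assms(1,2)])
  define b where "b x g = functional g (T x)" for x and g :: "'b dual"
  have b: "bounded_bilinear b"
    unfolding b_def
    by (rule bounded_bilinear.comp[OF bounded_bilinear.flip[OF bounded_bilinear_blinfun_apply]
          T bounded_linear_functional])
  have "(\<exists>u\<ge>0. \<forall>p\<in>labs ` A. \<forall>q\<in>(\<lambda>f. labs (Dual f)) ` B. b (ppart (p - u)) q \<le> \<epsilon>)
      \<and> (\<exists>g\<ge>0. \<forall>q\<in>(\<lambda>f. labs (Dual f)) ` B. \<forall>p\<in>labs ` A. b p (ppart (q - g)) \<le> \<epsilon>)"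
    if A: "rel_weakly_compact A" and B: "rel_weakly_compact B" and \<epsilon>: "\<epsilon> > 0"
    for A :: "'a set" and B :: "('b \<Rightarrow>\<^sub>L real) set" and \<epsilon> :: real
  proof -
    let ?P = "labs ` A" and ?Q = "(\<lambda>f. labs (Dual f)) ` B"
    have P: "bounded ?P" "\<And>p. p \<in> ?P \<Longrightarrow> 0 \<le> p"
      using rel_weakly_compact_imp_bounded[OF A] by (auto simp: bounded_iff)
    have Q: "bounded ?Q" "\<And>q. q \<in> ?Q \<Longrightarrow> 0 \<le> q"
      using rel_weakly_compact_imp_bounded[OF B] by (auto simp: bounded_iff norm_Dual)
    have vnull: "(\<lambda>n. blinfun_apply \<phi> (v n)) \<longlonglongrightarrow> 0"
      if p: "\<And>n. p n \<in> ?P" and v: "\<And>n. 0 \<le> v n" "\<And>n. v n \<le> p n" "disjoint_seq v"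
      for p v and \<phi> :: "'a \<Rightarrow>\<^sub>L real"
    proof -
      have "\<forall>n. \<exists>x. x \<in> A \<and> p n = labs x" using p by blast
      then obtain x where "\<forall>n. x n \<in> A \<and> p n = labs (x n)" using choice by metis
      then show ?thesis
        using disjoint_dominated_null[OF bounded_linear_ident A, of x v \<phi>] v by simp
    qed
    have gnull: "(\<lambda>n. blinfun_apply \<Phi> (g n)) \<longlonglongrightarrow> 0"
      if q: "\<And>n. q n \<in> ?Q" and g: "\<And>n. 0 \<le> g n" "\<And>n. g n \<le> q n" "disjoint_seq g"
      for q g and \<Phi> :: "'b dual \<Rightarrow>\<^sub>L real"
    proof -
      have "\<forall>n. \<exists>f. f \<in> B \<and> q n = labs (Dual f)" using q by blast
      then obtain f where "\<forall>n. f n \<in> B \<and> q n = labs (Dual (f n))" using choice by metis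
      then show ?thesis
        using disjoint_dominated_null[OF bounded_linear_Dual B, of f g \<Phi>] g by simp
    qed
    have dp: "(\<lambda>n. b (v n) (g n)) \<longlonglongrightarrow> 0"
      if "\<And>n. p n \<in> ?P" "\<And>n. 0 \<le> v n" "\<And>n. v n \<le> p n" "disjoint_seq v"
        "\<And>n. q n \<in> ?Q" "\<And>n. 0 \<le> g n" "\<And>n. g n \<le> q n" "disjoint_seq g" for p v q g
    proof -
      have "weakly_null v" using vnull[OF that(1-4)] by (simp add: weakly_null_def)
      \<comment> \<open>The hypothesis on \<open>T\<close> tests against the bidual of the original
        dual space, whereas \<open>gnull\<close> uses functionals on its ordered copy; composing
        with \<open>functional\<close> passes from one to the other.\<close>
      moreover have "weakly_null (\<lambda>n. functional (g n))"
        unfolding weakly_null_def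
      proof
        fix \<Phi> :: "('b \<Rightarrow>\<^sub>L real) \<Rightarrow>\<^sub>L real"
        show "(\<lambda>n. \<Phi> (functional (g n))) \<longlonglongrightarrow> 0"
          using gnull[OF that(5-8), of "\<Phi> o\<^sub>L Blinfun functional"]
          by (simp add: bounded_linear_Blinfun_apply[OF bounded_linear_functional])
      qed
      ultimately show ?thesis
        using assms(3) that(4,8) dual_disjoint_seq_functional[of g]
        unfolding almost_weak_DP_def b_def by blast
    qed
    have "\<exists>u\<ge>0. \<forall>p\<in>?P. \<forall>q\<in>?Q. b (ppart (p - u)) q \<le> \<epsilon>"
    proof (rule bilinear_disjoint_bound[OF b P Q _ dp \<epsilon>])
      fix p v and h :: "'b dual" and e :: real
      assume v: "\<And>n. p n \<in> ?P" "\<And>n. 0 \<le> v n" "\<And>n. v n \<le> p n" "disjoint_seq v" and h: "0 \<le> h" and e: "0 < e"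
      have hpos: "0 \<le> functional h y" if "0 \<le> y" for y using functional_mono[OF h that] by simp
      \<comment> \<open>For every \<open>k\<close> in \<open>[0, h]\<close> the value
        \<open>|k (T (v n))|\<close> is at most \<open>h |T (v n)|\<close>, hence at most
        \<open>\<phi> (v n)\<close>, a bound independent of \<open>k\<close> that tends to
        zero.\<close>
      obtain \<phi> :: "'a \<Rightarrow>\<^sub>L real" where \<phi>: "\<forall>x\<ge>0. functional h (labs (T x)) \<le> \<phi> x"
        using modulus_functional[OF assms(1,2) hpos] by auto
      obtain N where N: "\<And>n. n \<ge> N \<Longrightarrow> \<phi> (v n) < e"
        using order_tendstoD(2)[OF vnull[OF v] e] by (auto simp: eventually_sequentially)
      have "\<bar>b (v n) k\<bar> \<le> e" if "n \<ge> N" "k \<in> {0..h}" for n k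
        using abs_functional_le[of k h "T (v n)"] \<phi>[rule_format, OF v(2)[of n]] N[OF that(1)] that(2) by (simp add: b_def)
      then show "\<exists>N. \<forall>n\<ge>N. \<forall>k\<in>{0..h}. \<bar>b (v n) k\<bar> \<le> e" by blast
    qed
    moreover have "\<exists>g\<ge>0. \<forall>q\<in>?Q. \<forall>p\<in>?P. b p (ppart (q - g)) \<le> \<epsilon>"
    proof (rule bilinear_disjoint_bound[OF bounded_bilinear.flip[OF b] Q P _ _ \<epsilon>])
      fix q g and h :: 'a and e :: real
      assume g: "\<And>n. q n \<in> ?Q" "\<And>n. 0 \<le> g n" "\<And>n. g n \<le> q n" "disjoint_seq g" and h: "0 \<le> h" and e: "0 < e"
      \<comment> \<open>With roles exchanged the uniform bound is a single vector: all
        \<open>|T k|\<close> with \<open>k\<close> in \<open>[0, h]\<close> lie below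
        \<open>z\<close>, and evaluation at \<open>z\<close> is a continuous functional on the dual,
        so \<open>g n z\<close> tends to zero.\<close>
      obtain c d where cd: "T ` {0..h} \<subseteq> {c..d}" using order_bounded_op_interval[OF assms(2)] by blast
      define z where "z = labs c + labs d"
      have eval: "bounded_linear (\<lambda>f. functional f z)"
        by (intro bounded_linear_compose[OF bounded_linear_apply_blinfun bounded_linear_functional])
      from gnull[OF g, of "Blinfun (\<lambda>f. functional f z)"]
      have "(\<lambda>n. functional (g n) z) \<longlonglongrightarrow> 0" unfolding bounded_linear_Blinfun_apply[OF eval] .
      from order_tendstoD(2)[OF this e] obtain N where N: "\<And>n. n \<ge> N \<Longrightarrow> functional (g n) z < e"
        by (auto simp: eventually_sequentially)
      have "\<bar>b k (g n)\<bar> \<le> e" if "n \<ge> N" "k \<in> {0..h}" for n k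
      proof -
        have "\<bar>b k (g n)\<bar> \<le> functional (g n) (labs (T k))"
          unfolding b_def by (rule abs_functional_le) (use g in auto)
        also have "\<dots> \<le> functional (g n) z"
        proof (rule blinfun_mono)
          show "0 \<le> functional (g n) u" if "0 \<le> u" for u
            using functional_mono[OF g(2) that] by simp
          show "labs (T k) \<le> z" unfolding z_def
            by (rule labs_le_of_mem_interval) (use cd that(2) in blast)
        qed
        finally show ?thesis using N[OF that(1)] by simp
      qed
      then show "\<exists>N. \<forall>n\<ge>N. \<forall>k\<in>{0..h}. \<bar>b k (g n)\<bar> \<le> e" by blast
    qed (assumption | (rule dp, assumption+))+
    ultimately show ?thesis by blast
  qed
  then have main: "\<exists>u\<ge>0. \<forall>p\<in>labs ` A. \<forall>q\<in>(\<lambda>f. labs (Dual f)) ` B. b (ppart (p - u)) q \<le> \<epsilon>"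
    "\<exists>g\<ge>0. \<forall>q\<in>(\<lambda>f. labs (Dual f)) ` B. \<forall>p\<in>labs ` A. b p (ppart (q - g)) \<le> \<epsilon>"
    if "rel_weakly_compact A" "rel_weakly_compact B" "\<epsilon> > 0"
    for A :: "'a set" and B :: "('b \<Rightarrow>\<^sub>L real) set" and \<epsilon> :: real
    using that by blast+
  show ?thesis
  proof (intro conjI allI impI; elim conjE)
    fix A :: "'a set" and B :: "('b \<Rightarrow>\<^sub>L real) set" and \<epsilon> :: real
    assume AB: "rel_weakly_compact A" "rel_weakly_compact B" "\<epsilon> > 0"
    from main(1)[OF AB] show "\<exists>u\<ge>0. \<forall>x\<in>A. \<forall>f\<in>B.
        dual_abs (blinfun_apply f) (T (ppart (labs x - u))) \<le> \<epsilon>"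
      by (simp add: b_def dual_abs_blinfun)
    from main(2)[OF AB] obtain g where g: "0 \<le> g"
      "\<And>x f. x \<in> A \<Longrightarrow> f \<in> B \<Longrightarrow> b (labs x) (ppart (labs (Dual f) - g)) \<le> \<epsilon>"
      by blast
    have "dual_ppart (\<lambda>y. dual_abs (blinfun_apply f) y - functional g y)
        = functional (ppart (labs (Dual f) - g))" for f
      using dual_ppart_functional[of "labs (Dual f) - g"]
      by (simp add: dual_abs_blinfun blinfun.diff_left[abs_def])
    then show "\<exists>g :: 'b \<Rightarrow>\<^sub>L real. dual_nonneg (blinfun_apply g) \<and> (\<forall>x\<in>A. \<forall>f\<in>B.
        dual_ppart (\<lambda>y. dual_abs (blinfun_apply f) y - g y) (T (labs x)) \<le> \<epsilon>)"
      using g by (intro exI[of _ "functional g"]) (auto simp: dual_nonneg_functional b_def)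
  qed
qed

end
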